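(* Let $n\ge 2$ and let $\lambda$ be a partition of $n$ with $\ell$ parts of size $1$, such that $(n)$ and $\lambda$ have the same parity. Then $$\| P_{(n),\lambda} - U_{A_n}\| \le \frac{\max\{1,\ell\}}{2\sqrt{n-1}}.$$ The same statement holds with $U_{A_n^c}$ in place of $U_{A_n}$ when $(n)$ and $\lambda$ have opposite parity.
   Context: $S_n$ is the symmetric group on $\{1,\dots,n\}$, $A_n$ the set of even permutations and $A_n^c$ the set of odd permutations in $S_n$. For a partition $\alpha$ of $n$, $C_\alpha$ is the conjugacy class of permutations of cycle type $\alpha$; $(n)$ denotes the class of full $n$-cycles. A partition is called even (odd) if the permutations of that cycle type are even (odd). For partitions $\alpha,\beta$ of $n$, $P_{\alpha,\beta}$ is the probability distribution on $S_n$ of $\pi\sigma$, where $\pi$ and $\sigma$ are chosen independently and uniformly at random from $C_\alpha$ and $C_\beta$ respectively. For $X\subseteq S_n$, $U_X$ is the uniform distribution on $X$. The total variation distance of distributions $P,Q$ on a finite set $X$ is $\|P-Q\| = \tfrac12\sum_{x\in X}|P(x)-Q(x)|$. *)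

theory Defs
  imports
    "HOL-Probability.Probability_Mass_Function"
    "HOL-Combinatorics.Orbits"
    "HOL-Algebra.Sym_Groups"
begin

definition is_partition :: "nat multiset \<Rightarrow> nat \<Rightarrow> bool" where
  "is_partition \<alpha> n \<longleftrightarrow> 0 \<notin># \<alpha> \<and> sum_mset \<alpha> = n"

text \<open>The orbits are collected as a set, so each cycle (fixed points included) contributes
  exactly one part.\<close>

definition cycle_type :: "nat \<Rightarrow> (nat \<Rightarrow> nat) \<Rightarrow> nat multiset" where
  "cycle_type n p = image_mset card (mset_set (Orbits.orbit p ` {1..n}))"

definition cycle_class :: "nat \<Rightarrow> nat multiset \<Rightarrow> (nat \<Rightarrow> nat) set" where
  "cycle_class n \<alpha> = {p \<in> carrier (sym_group n). cycle_type n p = \<alpha>}"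

definition even_partition :: "nat \<Rightarrow> nat multiset \<Rightarrow> bool" where
  "even_partition n \<alpha> \<longleftrightarrow> (\<forall>p \<in> cycle_class n \<alpha>. evenperm p)"

definition odd_partition :: "nat \<Rightarrow> nat multiset \<Rightarrow> bool" where
  "odd_partition n \<alpha> \<longleftrightarrow> (\<forall>p \<in> cycle_class n \<alpha>. \<not> evenperm p)"

definition same_parity :: "nat \<Rightarrow> nat multiset \<Rightarrow> nat multiset \<Rightarrow> bool" where
  "same_parity n \<alpha> \<beta> \<longleftrightarrow>
     even_partition n \<alpha> \<and> even_partition n \<beta> \<or> odd_partition n \<alpha> \<and> odd_partition n \<beta>"

definition opposite_parity :: "nat \<Rightarrow> nat multiset \<Rightarrow> nat multiset \<Rightarrow> bool" where
  "opposite_parity n \<alpha> \<beta> \<longleftrightarrow>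
     even_partition n \<alpha> \<and> odd_partition n \<beta> \<or> odd_partition n \<alpha> \<and> even_partition n \<beta>"

text \<open>\<^const>\<open>pmf_of_set\<close> is the uniform distribution only on finite nonempty sets;
  \<open>cycle_class n \<alpha>\<close> is finite, and it is nonempty whenever \<open>\<alpha>\<close> is a partition of \<open>n\<close>.\<close>

definition class_product_pmf ::
    "nat \<Rightarrow> nat multiset \<Rightarrow> nat multiset \<Rightarrow> (nat \<Rightarrow> nat) pmf" where
  "class_product_pmf n \<alpha> \<beta> =
     map_pmf (\<lambda>(\<pi>, \<sigma>). \<pi> \<circ> \<sigma>)
       (pair_pmf (pmf_of_set (cycle_class n \<alpha>)) (pmf_of_set (cycle_class n \<beta>)))"

text \<open>Intended for distributions whose support lies in the finite set \<open>X\<close>.\<close>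

definition tv_dist :: "'a set \<Rightarrow> 'a pmf \<Rightarrow> 'a pmf \<Rightarrow> real" where
  "tv_dist X P Q = 1 / 2 * (\<Sum>x\<in>X. \<bar>pmf P x - pmf Q x\<bar>)"

end

theory Submission
  imports Defs
begin

text \<open>The hook characters of the symmetric group are treated through Young symmetrizers. For a point
  \<open>p\<close> and a \<open>k\<close>-set \<open>S\<close> not containing it, \<open>s(x)\<close> (\<open>hook_sign\<close>) is the sign of \<open>c\<close> if \<open>x = r c\<close> with \<open>r\<close>
  fixing \<open>S\<close> pointwise and \<open>c\<close> moving only points of \<open>S \<union> {p}\<close>, and \<open>0\<close> if there is no such
  factorization. The sum \<open>Z\<^sub>k\<close> (\<open>hook_sum\<close>) of \<open>s\<close> over all \<open>S\<close> is the character of the hook \<open>(n - k, 1\<^sup>k)\<close>: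
  it does not depend on \<open>p\<close>, averaging over a conjugacy class gives
  \<open>E Z\<^sub>k(g y) = Z\<^sub>k(g) E Z\<^sub>k(y) / (n - 1 choose k)\<close>, and \<open>\<Sum>\<^sub>k (-1)\<^sup>k Z\<^sub>k\<close> is \<open>n\<close> times the
  indicator of the \<open>n\<close>-cycles. The collision probability of \<open>\<pi> \<sigma>\<close> is thereby
  \<open>(1 / n!) \<Sum>\<^sub>k (Z\<^sub>k(\<lambda>) / (n - 1 choose k))\<^sup>2\<close>. The terms \<open>k = 0\<close> and \<open>k = n - 1\<close>
  account for the uniform distribution on a coset of the alternating group. For the others,
  \<open>Z\<^sub>k(x)\<close> is bounded by the number of \<open>k\<close>-sets \<open>S\<close> with \<open>x\<^sup>-\<^sup>1 S \<subseteq> S \<union> {p}\<close>, and adding or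
  removing one point of \<open>S\<close> shows that their proportion among all \<open>k\<close>-sets is at most
  \<open>max 1 l / max (k + 1) (n - k)\<close>. Cauchy-Schwarz turns this into the total variation bound.\<close>

section \<open>Hook symmetrizers\<close>

text \<open>The tableau of hook shape behind this has corner \<open>p\<close>, first row
  \<open>U - S\<close> and first column \<open>insert p S\<close>; \<open>r\<close> lies in its row
  group and \<open>c\<close> in its column group.\<close>

definition hook_factor :: "'a set \<Rightarrow> 'a set \<Rightarrow> 'a \<Rightarrow> ('a \<Rightarrow> 'a) \<Rightarrow> ('a \<Rightarrow> 'a) \<Rightarrow> ('a \<Rightarrow> 'a) \<Rightarrow> bool" where
  "hook_factor U S p x r c \<longleftrightarrow> r permutes (U - S) \<and> c permutes (insert p S) \<and> x = r \<circ> c"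

text \<open>Under the assumptions of the locale \<open>hook\<close>, the choice is unambiguous by
  \<open>factor_unique\<close>, and the value is the coefficient of \<open>x\<close> in the Young
  symmetrizer of the tableau.\<close>

definition hook_sign :: "'a set \<Rightarrow> 'a set \<Rightarrow> 'a \<Rightarrow> ('a \<Rightarrow> 'a) \<Rightarrow> real" where
  "hook_sign U S p x =
     (if \<exists>r c. hook_factor U S p x r c
      then real_of_int (sign (SOME c. \<exists>r. hook_factor U S p x r c)) else 0)"

locale hook =
  fixes U S :: "'a set" and p :: 'a
  assumes finite_U: "finite U" and p_in: "p \<in> U" and S_sub: "S \<subseteq> U - {p}"
begin

lemma finite_S: "finite S"
  using finite_U S_sub by (meson finite_Diff finite_subset)

lemma factor_permutes:
  assumes "hook_factor U S p x r c"
  shows "x permutes U" "r permutes U" "c permutes U"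
proof -
  show r: "r permutes U" using assms permutes_subset[of r "U - S" U]
    by (auto simp: hook_factor_def)
  show c: "c permutes U" using assms permutes_subset[of c "insert p S" U] p_in S_sub
    by (auto simp: hook_factor_def)
  show "x permutes U" using permutes_compose[OF c r] assms by (simp add: hook_factor_def)
qed

text \<open>Row and column share only the corner. The quotient of \<open>c\<close> and
  \<open>c'\<close> lies in both groups, so it permutes \<open>{p}\<close> and is the
  identity.\<close>

lemma factor_unique:
  assumes "hook_factor U S p x r c" "hook_factor U S p x r' c'"
  shows "c = c'"
proof -
  have r: "r permutes (U - S)" and c: "c permutes (insert p S)"
    and r': "r' permutes (U - S)" and c': "c' permutes (insert p S)"
    and eq: "r \<circ> c = r' \<circ> c'"
    using assms by (auto simp: hook_factor_def)
  define q where "q = c \<circ> inv' c'"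
  have q1: "q permutes insert p S"
    unfolding q_def using c c' by (intro permutes_compose permutes_inv)
  have "r \<circ> q = r'"
  proof
    fix y show "(r \<circ> q) y = r' y"
      using fun_cong[OF eq, of "inv' c' y"] permutes_inverses(1)[OF c'] by (simp add: q_def)
  qed
  then have "q = inv' r \<circ> r'"
    using permutes_inverses(2)[OF r] by (simp add: fun_eq_iff) metis
  then have q2: "q permutes U - S"
    using r r' by (auto intro: permutes_compose permutes_inv)
  have "q permutes {p}"
    using permutes_superset[OF q1, of "{p}"] permutes_not_in[OF q2] by auto
  then have "q = id" by simp
  then have "c (inv' c' y) = y" for y by (simp add: q_def fun_eq_iff)
  from this[of "c' _"] show ?thesis using permutes_inverses(2)[OF c'] by (auto simp: fun_eq_iff)
qed

lemma hook_sign_eq: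
  assumes "hook_factor U S p x r c"
  shows "hook_sign U S p x = sign c"
proof -
  have "(SOME c. \<exists>r. hook_factor U S p x r c) = c"
    using assms factor_unique by (intro some_equality) blast+
  then show ?thesis using assms by (auto simp: hook_sign_def)
qed

lemma sign_compose':
  assumes "c permutes insert p S" "c' permutes insert p S"
  shows "sign (c \<circ> c') = sign c * sign c'"
  using assms finite_S by (intro sign_compose) (auto simp: permutation_permutes)

lemma factor_mult:
  assumes "hook_factor U S p x r c" "r' permutes (U - S)" "c' permutes (insert p S)"
  shows "hook_factor U S p (r' \<circ> x \<circ> c') (r' \<circ> r) (c \<circ> c')"
  using assms by (auto simp: hook_factor_def permutes_compose comp_assoc)

text \<open>Row elements on the left and column elements on the right are absorbed into the two
  factors of \<open>x\<close>. Undoing the multiplication shows that no factorization can arise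
  where there was none.\<close>

lemma hook_sign_mult:
  assumes r: "r permutes (U - S)" and c: "c permutes (insert p S)"
  shows "hook_sign U S p (r \<circ> x \<circ> c) = sign c * hook_sign U S p x"
proof (cases "\<exists>r c. hook_factor U S p x r c")
  case True
  then obtain r0 c0 where f: "hook_factor U S p x r0 c0" by blast
  show ?thesis
    using hook_sign_eq[OF f] hook_sign_eq[OF factor_mult[OF f r c]] sign_compose'[of c0 c] f c
    by (simp add: hook_factor_def)
next
  case False
  have "\<not> (\<exists>r' c'. hook_factor U S p (r \<circ> x \<circ> c) r' c')"
  proof
    assume "\<exists>r' c'. hook_factor U S p (r \<circ> x \<circ> c) r' c'"
    then obtain r' c' where f: "hook_factor U S p (r \<circ> x \<circ> c) r' c'" by blast
    have "inv' r \<circ> (r \<circ> x \<circ> c) \<circ> inv' c = x"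
      using permutes_inverses[OF r] permutes_inverses[OF c] by (auto simp: fun_eq_iff)
    then have "hook_factor U S p x (inv' r \<circ> r') (c' \<circ> inv' c)"
      using factor_mult[OF f permutes_inv[OF r] permutes_inv[OF c]] by simp
    then show False using False by blast
  qed
  then show ?thesis using False by (simp add: hook_sign_def)
qed

text \<open>\<open>r\<close> maps \<open>U - S\<close> to itself, so \<open>x z\<close> can lie in
  \<open>S\<close> only if \<open>c z\<close> does, and then \<open>z\<close> belongs to the
  column.\<close>

lemma factor_imp_closed:
  assumes "hook_factor U S p x r c"
  shows "inv' x ` S \<subseteq> insert p S"
proof -
  have r: "r permutes (U - S)" and c: "c permutes (insert p S)" and x: "x = r \<circ> c"
    using assms by (auto simp: hook_factor_def)
  have xU: "x permutes U" using factor_permutes[OF assms] by blast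
  show ?thesis
  proof
    fix z assume "z \<in> inv' x ` S"
    then have "x z \<in> S" using permutes_inverses[OF xU] by auto
    then have "c z \<in> S"
      using permutes_in_image[OF r, of "c z"] permutes_not_in[OF r, of "c z"] by (auto simp: x)
    then show "z \<in> insert p S" using permutes_in_image[OF c, of z] by auto
  qed
qed

text \<open>The inverse of \<open>x\<close> embeds \<open>S\<close> into the column and misses
  exactly one point \<open>z\<close>. Sending \<open>p\<close> to \<open>z\<close> completes it to a
  permutation \<open>d\<close> of the column, and \<open>x \<circ> d\<close> fixes \<open>S\<close>
  pointwise.\<close>

lemma closed_imp_factor:
  assumes x: "x permutes U" and cl: "inv' x ` S \<subseteq> insert p S"
  shows "\<exists>r c. hook_factor U S p x r c"
proof -
  have xi: "inv' x permutes U" using x by (rule permutes_inv)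
  have pS: "p \<notin> S" using S_sub by blast
  have inj: "inj_on (inv' x) S" using xi permutes_inj_on by blast
  have "card (insert p S - inv' x ` S) = 1"
    using cl finite_S pS by (simp add: card_Diff_subset card_image[OF inj])
  then obtain z where z: "insert p S - inv' x ` S = {z}" by (auto simp: card_1_singleton_iff)
  define d where "d = (\<lambda>y. if y \<in> S then inv' x y else if y = p then z else y)"
  have img: "d ` insert p S = insert p S"
  proof -
    have "d ` insert p S = insert z (inv' x ` S)" using pS by (auto simp: d_def)
    also have "\<dots> = insert p S" using z cl by blast
    finally show ?thesis .
  qed
  then have inj': "inj_on d (insert p S)" using finite_S by (intro eq_card_imp_inj_on) auto
  have d: "d permutes insert p S"
    using img inj' by (intro bij_imp_permutes) (auto simp: bij_betw_def d_def)
  define r where "r = x \<circ> d"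
  have dU: "d permutes U" using permutes_subset[OF d] S_sub p_in by blast
  have rU: "r permutes U" unfolding r_def using dU x by (rule permutes_compose)
  have "r permutes (U - S)"
    using permutes_inverses[OF x] by (intro permutes_superset[OF rU]) (auto simp: r_def d_def)
  moreover have "x = r \<circ> inv' d" using permutes_inverses[OF d] by (auto simp: r_def fun_eq_iff)
  ultimately show ?thesis using permutes_inv[OF d] unfolding hook_factor_def by blast
qed

lemma factor_iff:
  assumes "x permutes U"
  shows "(\<exists>r c. hook_factor U S p x r c) \<longleftrightarrow> inv' x ` S \<subseteq> insert p S"
  using closed_imp_factor[OF assms] factor_imp_closed by blast

lemma hook_sign_eq_0:
  assumes "x permutes U" "\<not> inv' x ` S \<subseteq> insert p S"
  shows "hook_sign U S p x = 0"
  using assms factor_iff by (auto simp: hook_sign_def)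

lemma abs_hook_sign_le: "\<bar>hook_sign U S p x\<bar> \<le> 1"
  by (auto simp: hook_sign_def simp flip: of_int_abs)

text \<open>Von Neumann's lemma for Young symmetrizers: if \<open>x\<close> has no factorization, some transposition
  in the column group is conjugated by \<open>x\<close> into the row group, so \<open>v x = - v x\<close>.\<close>

lemma hook_equivariant:
  fixes v :: "('a \<Rightarrow> 'a) \<Rightarrow> real"
  assumes v: "\<And>x r c. x permutes U \<Longrightarrow> r permutes (U - S) \<Longrightarrow> c permutes (insert p S)
      \<Longrightarrow> v (r \<circ> x \<circ> c) = sign c * v x"
    and x: "x permutes U"
  shows "v x = hook_sign U S p x * v id"
proof (cases "inv' x ` S \<subseteq> insert p S")
  case True
  then obtain r c where f: "hook_factor U S p x r c" using factor_iff[OF x] by blast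
  then show ?thesis
    using v[OF permutes_id, of r c] hook_sign_eq[OF f] by (simp add: hook_factor_def)
next
  case False
  have pS: "p \<notin> S" using S_sub by blast
  \<comment> \<open>Pigeonhole: the preimage of \<open>S\<close> under \<open>x\<close> is not
    contained in the column, which has one point more than \<open>S\<close>. Hence at least two
    points of the column are mapped outside \<open>S\<close>, that is, into the row.\<close>
  have "insert p S \<inter> inv' x ` S \<subset> inv' x ` S" using False by blast
  then have "card (insert p S \<inter> inv' x ` S) < card (inv' x ` S)"
    using finite_S by (intro psubset_card_mono) auto
  then have "card (insert p S \<inter> inv' x ` S) < card S"
    using card_image_le[OF finite_S, of "inv' x"] by linarith
  then have "2 \<le> card (insert p S - inv' x ` S)"
    using card_Diff_subset_Int[of "insert p S" "inv' x ` S"] finite_S pS by simp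
  then obtain a b where ab: "a \<in> insert p S - inv' x ` S" "b \<in> insert p S - inv' x ` S" "a \<noteq> b"
    by (metis card_2_iff' card_le_Suc0_iff_eq finite_Diff finite_S finite_insert not_less_eq_eq numeral_2_eq_2)
  have abU: "a \<in> U" "b \<in> U" using ab S_sub p_in by auto
  have xab: "x z \<in> U - S" if "z \<in> insert p S - inv' x ` S" "z \<in> U" for z
  proof -
    have "x z \<notin> S" using that(1) imageI[of "x z" S "inv' x"] by (auto simp: permutes_inverses(2)[OF x])
    then show ?thesis using that(2) permutes_in_image[OF x] by simp
  qed
  have t: "Transposition.transpose a b permutes insert p S" "Transposition.transpose (x a) (x b) permutes U - S"
    using ab abU by (auto intro!: permutes_swap_id xab)
  have "x \<circ> Transposition.transpose a b = Transposition.transpose (x a) (x b) \<circ> x"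
    using permutes_inj[OF x] by (auto simp: fun_eq_iff Transposition.transpose_def inj_eq)
  moreover have "v (x \<circ> Transposition.transpose a b) = - v x"
    using v[OF x permutes_id t(1)] ab(3) by (simp add: sign_swap_id)
  moreover have "v (Transposition.transpose (x a) (x b) \<circ> x) = v x"
    using v[OF x t(2) permutes_id] by simp
  ultimately have "v x = 0" by simp
  then show ?thesis using hook_sign_eq_0[OF x False] by simp
qed

end

section \<open>Averaging over conjugation-closed sets\<close>

lemma permutes_conj:
  assumes c: "c permutes A" and h: "bij h"
  shows "(h \<circ> c \<circ> inv' h) permutes (h ` A)"
proof -
  have "bij (h \<circ> c \<circ> inv' h)"
    using h permutes_bij[OF c] by (intro bij_comp bij_imp_bij_inv)
  moreover have "(h \<circ> c \<circ> inv' h) y = y" if "y \<notin> h ` A" for y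
  proof -
    have "inv' h y \<notin> A" using that h by (metis bij_inv_eq_iff imageI)
    then show ?thesis using permutes_not_in[OF c] h by (simp add: bij_is_surj surj_f_inv_f)
  qed
  ultimately show ?thesis by (auto simp: permutes_def bij_iff)
qed

lemma sign_conj:
  assumes "permutation c" "permutation h"
  shows "sign (h \<circ> c \<circ> inv' h) = sign c"
  using assms by (simp add: sign_compose permutation_compose permutation_inverse sign_inverse)

lemma exists_permutes_image_eq:
  assumes X: "finite X" and S: "S \<subseteq> X" and S': "S' \<subseteq> X" and c: "card S = card S'"
  obtains h where "h permutes X" "h ` S = S'"
proof -
  have fin: "finite S" "finite S'" using assms finite_subset by blast+
  obtain f where f: "bij_betw f S S'"
    using finite_same_card_bij[OF fin c] by blast
  have "card (X - S) = card (X - S')" using c S S' fin by (simp add: card_Diff_subset)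
  then obtain g where g: "bij_betw g (X - S) (X - S')"
    using finite_same_card_bij[of "X - S" "X - S'"] X by blast
  define h where "h = (\<lambda>x. if x \<in> S then f x else if x \<in> X then g x else x)"
  have h1: "bij_betw h S S'" using f bij_betw_cong[of S h f] by (simp add: h_def)
  have h2: "bij_betw h (X - S) (X - S')" using g bij_betw_cong[of "X - S" h g] by (simp add: h_def)
  have "bij_betw h (S \<union> (X - S)) (S' \<union> (X - S'))"
    using h1 h2 by (rule bij_betw_combine) blast
  then have "bij_betw h X X" using S S' by (simp add: Un_absorb1)
  then have "h permutes X" using S by (intro bij_imp_permutes) (auto simp: h_def)
  then show thesis using that h1 by (auto simp: bij_betw_def)
qed

definition conj_closed :: "'a set \<Rightarrow> ('a \<Rightarrow> 'a) set \<Rightarrow> bool" where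
  "conj_closed U K \<longleftrightarrow> (\<forall>x\<in>K. x permutes U) \<and>
     (\<forall>h x. h permutes U \<longrightarrow> x \<in> K \<longrightarrow> h \<circ> x \<circ> inv' h \<in> K)"

lemma conj_closed_bij:
  assumes K: "conj_closed U K" and h: "h permutes U"
  shows "bij_betw (\<lambda>x. h \<circ> x \<circ> inv' h) K K"
proof (rule bij_betwI[where g = "\<lambda>x. inv' h \<circ> x \<circ> h"])
  show "(\<lambda>x. h \<circ> x \<circ> inv' h) \<in> K \<rightarrow> K" using K h by (auto simp: conj_closed_def)
  have "inv' h \<circ> x \<circ> inv' (inv' h) \<in> K" if "x \<in> K" for x
    using K permutes_inv[OF h] that unfolding conj_closed_def by blast
  then show "(\<lambda>x. inv' h \<circ> x \<circ> h) \<in> K \<rightarrow> K" using permutes_inv_inv[OF h] by auto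
qed (use permutes_inverses[OF h] in \<open>auto simp: fun_eq_iff\<close>)

section \<open>Relabelling of hook tableaux and averages over conjugates\<close>

context hook
begin

lemma factor_conj:
  assumes f: "hook_factor U S p x r c" and h: "h permutes U"
  shows "hook_factor U (h ` S) (h p) (h \<circ> x \<circ> inv' h) (h \<circ> r \<circ> inv' h) (h \<circ> c \<circ> inv' h)"
proof -
  have "h ` (U - S) = U - h ` S"
    using permutes_image[OF h] permutes_inj[OF h] by (simp add: image_set_diff)
  then have "(h \<circ> r \<circ> inv' h) permutes (U - h ` S)"
    using f permutes_conj[OF _ permutes_bij[OF h], of r "U - S"] by (simp add: hook_factor_def)
  moreover have "(h \<circ> c \<circ> inv' h) permutes (insert (h p) (h ` S))"
    using f permutes_conj[OF _ permutes_bij[OF h], of c "insert p S"] by (simp add: hook_factor_def)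
  moreover have "h \<circ> x \<circ> inv' h = (h \<circ> r \<circ> inv' h) \<circ> (h \<circ> c \<circ> inv' h)"
    using f permutes_inverses[OF h] by (auto simp: hook_factor_def fun_eq_iff)
  ultimately show ?thesis by (simp add: hook_factor_def)
qed

lemma hook_image:
  assumes h: "h permutes U"
  shows "hook U (h ` S) (h p)"
proof
  show "finite U" by (rule finite_U)
  show "h p \<in> U" using p_in permutes_in_image[OF h] by simp
  show "h ` S \<subseteq> U - {h p}"
    using S_sub permutes_in_image[OF h] permutes_inj[OF h] by (auto simp: inj_eq)
qed

text \<open>Conjugation by \<open>h\<close> carries factorizations for one tableau to factorizations
  for the relabelled one, and it preserves the sign of the column factor.\<close>

lemma hook_sign_conj:
  assumes h: "h permutes U"
  shows "hook_sign U (h ` S) (h p) (h \<circ> x \<circ> inv' h) = hook_sign U S p x"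
proof -
  interpret h: hook U "h ` S" "h p" by (rule hook_image[OF h])
  show ?thesis
  proof (cases "\<exists>r c. hook_factor U S p x r c")
    case True
    then obtain r c where f: "hook_factor U S p x r c" by blast
    have "permutation c" "permutation h"
      using factor_permutes[OF f] h finite_U by (auto simp: permutation_permutes)
    then show ?thesis
      using hook_sign_eq[OF f] h.hook_sign_eq[OF factor_conj[OF f h]] sign_conj by simp
  next
    case False
    have "\<not> (\<exists>r c. hook_factor U (h ` S) (h p) (h \<circ> x \<circ> inv' h) r c)"
    proof
      assume "\<exists>r c. hook_factor U (h ` S) (h p) (h \<circ> x \<circ> inv' h) r c"
      then obtain r c where "hook_factor U (h ` S) (h p) (h \<circ> x \<circ> inv' h) r c" by blast
      from h.factor_conj[OF this permutes_inv[OF h]] show False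
        using False permutes_inv_inv[OF h] permutes_inverses[OF h]
        by (auto simp: o_def image_comp)
    qed
    then show ?thesis using False by (simp add: hook_sign_def)
  qed
qed

text \<open>As a function of \<open>g\<close>, the left side has the same row and column
  equivariance as \<open>hook_sign\<close>: a column element to the right of \<open>g\<close> is
  moved past \<open>y\<close> by replacing \<open>y\<close> with a conjugate, which only permutes
  \<open>K\<close>. Hence \<open>hook_equivariant\<close> applies, and the constant is the value at
  \<open>id\<close>.\<close>

lemma sum_hook_sign_conj_closed:
  assumes K: "conj_closed U K" and g: "g permutes U"
  shows "(\<Sum>y\<in>K. hook_sign U S p (g \<circ> y)) = hook_sign U S p g * (\<Sum>y\<in>K. hook_sign U S p y)"
proof -
  define v where "v = (\<lambda>g. \<Sum>y\<in>K. hook_sign U S p (g \<circ> y))"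
  have "v (r \<circ> x \<circ> c) = sign c * v x"
    if "x permutes U" and r: "r permutes U - S" and c: "c permutes insert p S" for x r c
  proof -
    have cU: "c permutes U" using permutes_subset[OF c] S_sub p_in by blast
    have "r \<circ> x \<circ> c \<circ> y = r \<circ> (x \<circ> (c \<circ> y \<circ> inv' c)) \<circ> c" for y
      using permutes_inverses[OF c] by (auto simp: fun_eq_iff)
    then have "v (r \<circ> x \<circ> c) = (\<Sum>y\<in>K. sign c * hook_sign U S p (x \<circ> (c \<circ> y \<circ> inv' c)))"
      unfolding v_def by (simp only: hook_sign_mult[OF r c])
    also have "\<dots> = sign c * (\<Sum>y\<in>K. hook_sign U S p (x \<circ> (c \<circ> y \<circ> inv' c)))"
      by (simp add: sum_distrib_left)
    also have "(\<Sum>y\<in>K. hook_sign U S p (x \<circ> (c \<circ> y \<circ> inv' c))) = v x"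
      unfolding v_def by (rule sum.reindex_bij_betw[OF conj_closed_bij[OF K cU]])
    finally show ?thesis .
  qed
  then have "v g = hook_sign U S p g * v id"
    using g by (rule hook_equivariant)
  then show ?thesis by (simp add: v_def)
qed

end

definition hook_sum :: "'a set \<Rightarrow> nat \<Rightarrow> 'a \<Rightarrow> ('a \<Rightarrow> 'a) \<Rightarrow> real" where
  "hook_sum U k p x = (\<Sum>S | S \<subseteq> U - {p} \<and> card S = k. hook_sign U S p x)"

text \<open>The constants \<open>V S\<close> from \<open>sum_hook_sign_conj_closed\<close> do not
  depend on \<open>S\<close>: a permutation that fixes \<open>p\<close> and carries \<open>S\<close>
  to \<open>S'\<close> acts on \<open>K\<close> by conjugation. Their total is therefore the number
  of sets \<open>S\<close> times any one of them. In terms of characters, averaging over a class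
  multiplies by the normalized character value.\<close>

lemma hook_sum_mult:
  assumes U: "finite U" and p: "p \<in> U" and K: "conj_closed U K" and g: "g permutes U"
  shows "((card U - 1) choose k) * (\<Sum>y\<in>K. hook_sum U k p (g \<circ> y))
         = hook_sum U k p g * (\<Sum>y\<in>K. hook_sum U k p y)"
proof -
  let ?F = "{S. S \<subseteq> U - {p} \<and> card S = k}"
  have hook: "hook U S p" if "S \<in> ?F" for S using that U p by unfold_locales auto
  have cF: "card ?F = (card U - 1) choose k"
    using n_subsets[of "U - {p}" k] U p by simp
  define V where "V = (\<lambda>S. \<Sum>y\<in>K. hook_sign U S p y)"
  have V: "V S = V S'" if S: "S \<in> ?F" and S': "S' \<in> ?F" for S S'
  proof -
    interpret hook U S p by (rule hook[OF S])
    obtain h where h: "h permutes U - {p}" "h ` S = S'"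
      using exists_permutes_image_eq[of "U - {p}" S S'] U S S' by auto
    have hU: "h permutes U" using h(1) by (rule permutes_subset) auto
    have hp: "h p = p" using permutes_not_in[OF h(1)] by auto
    have "V S' = (\<Sum>y\<in>K. hook_sign U S' p (h \<circ> y \<circ> inv' h))"
      unfolding V_def by (rule sum.reindex_bij_betw[OF conj_closed_bij[OF K hU], symmetric])
    also have "\<dots> = V S"
      using hook_sign_conj[OF hU] h(2) hp by (simp add: V_def)
    finally show ?thesis by simp
  qed
  have tot: "(\<Sum>y\<in>K. hook_sum U k p y) = (\<Sum>S\<in>?F. V S)"
    unfolding hook_sum_def V_def by (rule sum.swap)
  have "(\<Sum>y\<in>K. hook_sum U k p (g \<circ> y)) = (\<Sum>S\<in>?F. \<Sum>y\<in>K. hook_sign U S p (g \<circ> y))"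
    unfolding hook_sum_def by (rule sum.swap)
  also have "\<dots> = (\<Sum>S\<in>?F. hook_sign U S p g * V S)"
    unfolding V_def by (intro sum.cong refl hook.sum_hook_sign_conj_closed[OF hook _ g] K)
  finally have "card ?F * (\<Sum>y\<in>K. hook_sum U k p (g \<circ> y))
      = (\<Sum>S\<in>?F. hook_sign U S p g * (card ?F * V S))"
    by (simp add: sum_distrib_left mult_ac)
  also have "\<dots> = (\<Sum>S\<in>?F. hook_sign U S p g * (\<Sum>S\<in>?F. V S))"
  proof (intro sum.cong refl)
    fix S assume S: "S \<in> ?F"
    have "(\<Sum>S'\<in>?F. V S') = card ?F * V S" using V[OF _ S] by simp
    then show "hook_sign U S p g * (card ?F * V S) = hook_sign U S p g * (\<Sum>S\<in>?F. V S)"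
      by simp
  qed
  finally show ?thesis using tot by (simp add: cF hook_sum_def sum_distrib_right)
qed

section \<open>Independence of the base point\<close>

lemma permutes_restrict_id':
  assumes x: "x permutes U" and A: "x ` A = A"
  shows "restrict_id x A permutes A"
  using A inj_on_subset[OF permutes_inj[OF x], of A]
  by (intro permutes_restrict_id) (auto simp: bij_betw_def)

context hook
begin

lemma closed_iff:
  assumes x: "x permutes U"
  shows "inv' x ` S \<subseteq> insert p S \<longleftrightarrow> S \<subseteq> x ` insert p S"
proof -
  have "inv' x ` S \<subseteq> insert p S \<longleftrightarrow> x ` (inv' x ` S) \<subseteq> x ` insert p S"
    by (rule inj_image_subset_iff[OF permutes_inj[OF x], symmetric])
  then show ?thesis using permutes_inverses(1)[OF x] by (simp add: image_image)
qed

lemma hook_sign_not_closed: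
  assumes "x permutes U" "\<not> S \<subseteq> x ` insert p S"
  shows "hook_sign U S p x = 0"
  using assms hook_sign_eq_0 closed_iff by blast

text \<open>Here the restrictions of \<open>x\<close> to \<open>U - S\<close> and to
  \<open>S\<close> are the two factors.\<close>

lemma hook_sign_invariant:
  assumes x: "x permutes U" and S: "x ` S = S"
  shows "hook_sign U S p x = sign_on S x"
proof -
  have "x ` (U - S) = U - S"
    using permutes_image[OF x] S by (simp add: image_set_diff[OF permutes_inj[OF x]])
  then have "restrict_id x (U - S) permutes U - S" by (rule permutes_restrict_id'[OF x])
  moreover have "restrict_id x S permutes insert p S"
    using permutes_restrict_id'[OF x S] by (rule permutes_subset) auto
  moreover have "x = restrict_id x (U - S) \<circ> restrict_id x S"
    using imageI[of _ S x] S permutes_not_in[OF x] by (auto simp: restrict_id_def fun_eq_iff)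
  ultimately show ?thesis unfolding sign_on_def by (intro hook_sign_eq) (auto simp: hook_factor_def)
qed

text \<open>The whole column is invariant, so \<open>x\<close> splits along it; the row factor then
  fixes \<open>p\<close> as well.\<close>

lemma hook_sign_insert_invariant:
  assumes x: "x permutes U" and S: "x ` insert p S = insert p S"
  shows "hook_sign U S p x = sign_on (insert p S) x"
proof -
  let ?T = "insert p S"
  have "x ` (U - ?T) = U - ?T"
    using permutes_image[OF x] S by (simp only: image_set_diff[OF permutes_inj[OF x]])
  then have "restrict_id x (U - ?T) permutes U - ?T" by (rule permutes_restrict_id'[OF x])
  then have "restrict_id x (U - ?T) permutes U - S" by (rule permutes_subset) auto
  moreover have "restrict_id x ?T permutes ?T"
    using x S by (rule permutes_restrict_id')
  moreover have "x = restrict_id x (U - ?T) \<circ> restrict_id x ?T"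
    using imageI[of _ ?T x] S permutes_not_in[OF x] by (auto simp: restrict_id_def fun_eq_iff)
  ultimately show ?thesis unfolding sign_on_def by (intro hook_sign_eq) (auto simp: hook_factor_def)
qed

lemma factor_image:
  assumes "hook_factor U S p x r c"
  shows "x ` insert p S = insert (r p) S"
proof -
  have r: "r permutes (U - S)" and c: "c permutes (insert p S)" and x: "x = r \<circ> c"
    using assms by (auto simp: hook_factor_def)
  have "x ` insert p S = r ` insert p S"
    using permutes_image[OF c] by (metis x image_comp)
  also have "\<dots> = insert (r p) S" using permutes_not_in[OF r] by auto
  finally show ?thesis .
qed

text \<open>The image of the column is \<open>S\<close> together with \<open>y = r p\<close>. With
  the transposition \<open>t\<close> of \<open>y\<close> and \<open>p\<close>, the factorization
  \<open>(r \<circ> t) \<circ> (t \<circ> c)\<close> belongs to the enlarged set, because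
  \<open>r \<circ> t\<close> fixes \<open>y\<close>; the column factor changes sign.\<close>

lemma hook_sign_flip:
  assumes x: "x permutes U" and S: "S \<subseteq> x ` insert p S" and p: "p \<notin> x ` insert p S"
  shows "hook_sign U (x ` insert p S) p x = - hook_sign U S p x"
proof -
  obtain r c where f: "hook_factor U S p x r c"
    using factor_iff[OF x] closed_iff[OF x] S by blast
  have r: "r permutes (U - S)" and c: "c permutes (insert p S)" and xrc: "x = r \<circ> c"
    using f by (auto simp: hook_factor_def)
  define y where "y = r p"
  have pS: "p \<notin> S" using S_sub by blast
  have img: "x ` insert p S = insert y S" using factor_image[OF f] by (simp add: y_def)
  have yp: "y \<noteq> p" using p img by auto
  have y: "y \<in> U - S" unfolding y_def using permutes_in_image[OF r, of p] p_in pS by simp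
  define t where "t = Transposition.transpose y p"
  have t: "t permutes U - S" unfolding t_def using y p_in pS by (auto intro: permutes_swap_id)
  have "(r \<circ> t) permutes U - insert y S"
    using permutes_compose[OF t r]
    by (rule permutes_superset) (auto simp: t_def y_def)
  moreover have c': "c permutes insert p (insert y S)"
    using c by (rule permutes_subset) auto
  moreover have t': "t permutes insert p (insert y S)"
    unfolding t_def by (auto intro: permutes_swap_id)
  moreover have "x = (r \<circ> t) \<circ> (t \<circ> c)" by (auto simp: xrc t_def fun_eq_iff)
  ultimately have f': "hook_factor U (insert y S) p x (r \<circ> t) (t \<circ> c)"
    by (auto simp: hook_factor_def intro: permutes_compose)
  interpret y: hook U "insert y S" p
    using y yp by unfold_locales (use finite_U p_in S_sub in auto)
  show ?thesis
    using hook_sign_eq[OF f] y.hook_sign_eq[OF f'] y.sign_compose'[OF t' c'] yp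
    by (simp add: img t_def sign_swap_id del: image_insert)
qed

end

text \<open>This is the trace of \<open>x\<close> on the \<open>k\<close>-th exterior power of the
  permutation representation. Splitting off the trivial summand writes this power as the sum of the
  \<open>k\<close>-th and \<open>(k - 1)\<close>-th exterior powers of the complement, whose
  characters are those of hooks.\<close>

definition invariant_sum :: "'a set \<Rightarrow> nat \<Rightarrow> ('a \<Rightarrow> 'a) \<Rightarrow> real" where
  "invariant_sum U k x = (\<Sum>W | W \<subseteq> U \<and> card W = k \<and> x ` W = W. real_of_int (sign_on W x))"

text \<open>Non-invariant closed sets \<open>S\<close> of size \<open>k\<close> and \<open>x ` insert p S\<close> of size \<open>k + 1\<close>
  cancel in pairs.\<close>

lemma hook_sum_Suc:
  assumes U: "finite U" and p: "p \<in> U" and x: "x permutes U"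
  shows "hook_sum U (Suc k) p x + hook_sum U k p x = invariant_sum U (Suc k) x"
proof -
  define F where "F k = {S. S \<subseteq> U - {p} \<and> card S = k}" for k
  define A where "A = {S \<in> F (Suc k). S \<subseteq> x ` insert p S \<and> x ` S \<noteq> S}"
  define B where "B = {S \<in> F k. S \<subseteq> x ` insert p S \<and> x ` insert p S \<noteq> insert p S}"
  define I where "I = {S \<in> F (Suc k). x ` S = S}"
  define J where "J = {S \<in> F k. x ` insert p S = insert p S}"
  define w where "w S = hook_sign U S p x" for S
  have injx: "inj x" using x by (rule permutes_inj)
  have finF: "finite (F k)" for k unfolding F_def using U by simp
  have finS: "finite S" if "S \<subseteq> U" for S using that U finite_subset by blast
  have hook: "hook U S p" if "S \<in> F k" for S k
    using that U p by unfold_locales (auto simp: F_def)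
  have cardx: "card (x ` S) = card S" for S
    by (rule card_image[OF inj_on_subset[OF injx]]) simp
  \<comment> \<open>Otherwise the column is contained in its image under \<open>x\<close> and equals
    it by cardinality, which \<open>B\<close> excludes.\<close>
  have pB: "p \<notin> x ` insert p S" if "S \<in> B" for S
  proof
    assume "p \<in> x ` insert p S"
    then have "insert p S \<subseteq> x ` insert p S" using that by (auto simp: B_def)
    moreover have "finite (insert p S)" using that finS p by (auto simp: B_def F_def)
    ultimately have "insert p S = x ` insert p S"
      using cardx[of "insert p S"] by (intro card_subset_eq) auto
    then show False using that unfolding B_def by blast
  qed
  have "hook_sum U (Suc k) p x = sum w (F (Suc k))"
    by (simp add: hook_sum_def F_def w_def)
  also have "\<dots> = sum w (I \<union> A)"
  proof (rule sum.mono_neutral_right[OF finF])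
    show "I \<union> A \<subseteq> F (Suc k)" by (auto simp: I_def A_def)
    show "\<forall>S\<in>F (Suc k) - (I \<union> A). w S = 0"
      using hook.hook_sign_not_closed[OF hook x] unfolding I_def A_def w_def by blast
  qed
  also have "\<dots> = sum w I + sum w A"
    using finF by (intro sum.union_disjoint) (auto simp: I_def A_def)
  also have "sum w I = (\<Sum>S\<in>I. real_of_int (sign_on S x))"
    unfolding w_def I_def using hook.hook_sign_invariant[OF hook x] by (intro sum.cong refl) blast
  finally have 1: "hook_sum U (Suc k) p x = (\<Sum>S\<in>I. real_of_int (sign_on S x)) + sum w A" by simp
  have "hook_sum U k p x = sum w (F k)"
    by (simp add: hook_sum_def F_def w_def)
  also have "\<dots> = sum w (J \<union> B)"
  proof (rule sum.mono_neutral_right[OF finF])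
    show "J \<union> B \<subseteq> F k" by (auto simp: J_def B_def)
    show "\<forall>S\<in>F k - (J \<union> B). w S = 0"
      using hook.hook_sign_not_closed[OF hook x] unfolding J_def B_def w_def by blast
  qed
  also have "\<dots> = sum w J + sum w B"
    using finF by (intro sum.union_disjoint) (auto simp: J_def B_def)
  also have "sum w J = (\<Sum>S\<in>J. real_of_int (sign_on (insert p S) x))"
    unfolding w_def J_def using hook.hook_sign_insert_invariant[OF hook x]
    by (intro sum.cong refl) blast
  also have "\<dots> = (\<Sum>W\<in>insert p ` J. real_of_int (sign_on W x))"
    by (subst sum.reindex) (auto simp: inj_on_def J_def F_def o_def)
  finally have 2: "hook_sum U k p x = (\<Sum>W\<in>insert p ` J. real_of_int (sign_on W x)) + sum w B" by simp
  \<comment> \<open>The pairing from \<open>A\<close> to \<open>B\<close>: the preimage of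
    \<open>S\<close> contains \<open>p\<close>, since otherwise it would lie inside \<open>S\<close>
    and \<open>S\<close> would be invariant. Removing \<open>p\<close> gives the partner of size
    \<open>k\<close>.\<close>
  have A: "x ` insert p (inv' x ` S - {p}) = S" "inv' x ` S - {p} \<in> B" if S: "S \<in> A" for S
  proof -
    have Ssub: "S \<subseteq> U - {p}" "card S = Suc k" "S \<subseteq> x ` insert p S" "x ` S \<noteq> S"
      using S by (auto simp: A_def F_def)
    have xinv: "x ` (inv' x ` S) = S" using permutes_inverses(1)[OF x] by (simp add: image_image)
    have sub: "inv' x ` S \<subseteq> insert p S"
      using hook.closed_iff[OF hook x, of S "Suc k"] S by (auto simp: A_def)
    have cinv: "card (inv' x ` S) = Suc k" using cardx[of "inv' x ` S"] xinv Ssub(2) by simp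
    have pin: "p \<in> inv' x ` S"
    proof (rule ccontr)
      assume "p \<notin> inv' x ` S"
      then have "inv' x ` S \<subseteq> S" using sub by blast
      then have "inv' x ` S = S" using finS[of S] Ssub cinv by (intro card_subset_eq) auto
      then show False using xinv Ssub(4) by simp
    qed
    have ins: "insert p (inv' x ` S - {p}) = inv' x ` S" using pin by blast
    show "x ` insert p (inv' x ` S - {p}) = S" unfolding ins xinv ..
    have "inv' x ` S - {p} \<subseteq> S" using sub by blast
    moreover have "card (inv' x ` S - {p}) = k" using cinv pin by (simp add: card_Diff_singleton)
    moreover have "S \<noteq> inv' x ` S" using pin Ssub(1) by blast
    ultimately show "inv' x ` S - {p} \<in> B"
      unfolding B_def F_def mem_Collect_eq ins xinv using Ssub(1) by blast
  qed
  have B: "inv' x ` x ` insert p S - {p} = S" "x ` insert p S \<in> A" if S: "S \<in> B" for S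
  proof -
    have SF: "S \<in> F k" and cl: "S \<subseteq> x ` insert p S" using S by (auto simp: B_def)
    have pS: "p \<notin> S" using SF by (auto simp: F_def)
    have fS: "finite S" using finS[of S] SF by (auto simp: F_def)
    have "inv' x ` x ` insert p S = insert p S"
      using permutes_inverses(2)[OF x] by (simp only: image_image) simp
    then show "inv' x ` x ` insert p S - {p} = S" using pS by simp
    have "insert p S \<subseteq> U" using SF p by (auto simp: F_def)
    then have "x ` insert p S \<subseteq> U" using image_mono[of "insert p S" U x] permutes_image[OF x] by simp
    moreover have "card (x ` insert p S) = Suc k"
      using cardx[of "insert p S"] pS fS SF by (simp add: F_def)
    moreover have "x ` (x ` insert p S) \<noteq> x ` insert p S"
      using inj_image_eq_iff[OF injx, of "x ` insert p S" "insert p S"] pB[OF S] by blast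
    moreover have "x ` insert p S \<subseteq> x ` insert p (x ` insert p S)"
      using cl by (intro image_mono) auto
    ultimately show "x ` insert p S \<in> A"
      using pB[OF S] unfolding A_def F_def by blast
  qed
  have flip: "w (x ` insert p S) = - w S" if "S \<in> B" for S
    unfolding w_def using that pB[OF that]
    by (intro hook.hook_sign_flip[OF hook x]) (auto simp: B_def)
  have "sum w A = (\<Sum>S\<in>B. - w S)"
    by (rule sum.reindex_bij_witness[where i = "\<lambda>S. x ` insert p S" and j = "\<lambda>S. inv' x ` S - {p}"])
      (use A B flip in metis)+
  then have BA: "sum w A = - sum w B" by (simp add: sum_negf)
  have finI: "finite I" and finJ: "finite J" unfolding I_def J_def using finF by simp_all
  have dis: "I \<inter> insert p ` J = {}" by (auto simp: I_def F_def)
  \<comment> \<open>Invariant sets are split by membership of \<open>p\<close>: those that avoid it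
    form \<open>I\<close>, the others arise from \<open>J\<close> by adjoining
    \<open>p\<close>.\<close>
  have "{W. W \<subseteq> U \<and> card W = Suc k \<and> x ` W = W} = I \<union> insert p ` J"
  proof (rule equalityI; rule subsetI)
    fix W assume W: "W \<in> {W. W \<subseteq> U \<and> card W = Suc k \<and> x ` W = W}"
    show "W \<in> I \<union> insert p ` J"
    proof (cases "p \<in> W")
      case True
      then have "W = insert p (W - {p})" by blast
      moreover have "W - {p} \<in> J" using W True calculation by (auto simp: J_def F_def card_Diff_singleton_if)
      ultimately show ?thesis by blast
    qed (use W in \<open>auto simp: I_def F_def\<close>)
  next
    fix W assume "W \<in> I \<union> insert p ` J"
    moreover have "card (insert p S) = Suc k" if "S \<in> J" for S
      using that finS[of S] by (subst card_insert_disjoint) (auto simp: J_def F_def)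
    ultimately show "W \<in> {W. W \<subseteq> U \<and> card W = Suc k \<and> x ` W = W}"
      using p by (auto simp: I_def J_def F_def)
  qed
  then have "invariant_sum U (Suc k) x = (\<Sum>S\<in>I. real_of_int (sign_on S x))
      + (\<Sum>W\<in>insert p ` J. real_of_int (sign_on W x))"
    unfolding invariant_sum_def
    using sum.union_disjoint[of I "insert p ` J" "\<lambda>W. real_of_int (sign_on W x)"] finI finJ dis by simp
  then show ?thesis using 1 2 BA by simp
qed

section \<open>Full cycles\<close>

lemma hook_sum_0:
  assumes "finite U" "p \<in> U" "x permutes U"
  shows "hook_sum U 0 p x = 1"
proof -
  interpret hook U "{}" p using assms by unfold_locales auto
  have "{S. S \<subseteq> U - {p} \<and> card S = 0} = {{}}"
    using assms(1) by (auto dest: finite_subset)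
  then show ?thesis
    using hook_sign_eq[of x x id] assms(3)
    by (simp add: hook_sum_def hook_factor_def permutes_id)
qed

text \<open>The recursion \<open>hook_sum_Suc\<close> determines all hook sums from the one for
  \<open>k = 0\<close>, and neither its right side nor this initial value 1 refers to the base
  point.\<close>

lemma hook_sum_indep:
  assumes U: "finite U" and p: "p \<in> U" and q: "q \<in> U" and x: "x permutes U"
  shows "hook_sum U k p x = hook_sum U k q x"
proof (induction k)
  case 0
  show ?case using hook_sum_0[OF U _ x] p q by simp
next
  case (Suc k)
  then show ?case using hook_sum_Suc[OF U p x, of k] hook_sum_Suc[OF U q x, of k] by simp
qed

lemma cyclic_on_invariant_subset:
  assumes D: "cyclic_on x D" and W: "W \<subseteq> D" "W \<noteq> {}" "x ` W \<subseteq> W"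
  shows "W = D"
proof -
  obtain w where w: "w \<in> W" using W by blast
  have "orbit x w \<subseteq> W"
  proof
    fix z assume "z \<in> orbit x w"
    then show "z \<in> W" by induction (use w W in auto)
  qed
  then show ?thesis using orbit_cyclic_eq3[OF D, of w] w W by blast
qed

lemma cyclic_on_image_eq:
  assumes "cyclic_on x D" "inj x"
  shows "x ` D = D"
proof (rule card_subset_eq)
  show "x ` D \<subseteq> D" using cyclic_on_inI[OF assms(1)] by blast
  show "finite D" by (rule finite_cyclic_on[OF assms(1)])
  show "card (x ` D) = card D" using assms(2) by (intro card_image inj_on_subset[OF assms(2)]) auto
qed

text \<open>A full cycle has no invariant set of size strictly between 0 and \<open>card U\<close>,
  so each step of the recursion \<open>hook_sum_Suc\<close> below \<open>card U\<close> is a mere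
  change of sign.\<close>

lemma hook_sum_cyclic:
  assumes U: "finite U" and p: "p \<in> U" and x: "x permutes U" and cyc: "cyclic_on x U"
    and k: "k < card U"
  shows "hook_sum U k p x = (-1) ^ k"
  using k
proof (induction k)
  case 0
  show ?case using hook_sum_0[OF U p x] by simp
next
  case (Suc k)
  have no: "{W. W \<subseteq> U \<and> card W = Suc k \<and> x ` W = W} = {}"
  proof -
    have False if "W \<subseteq> U" "card W = Suc k" "x ` W = W" for W
    proof -
      have "W = U" using that by (intro cyclic_on_invariant_subset[OF cyc]) auto
      then show False using that(2) Suc.prems by simp
    qed
    then show ?thesis by blast
  qed
  have "invariant_sum U (Suc k) x = 0" unfolding invariant_sum_def no by simp
  then show ?case using hook_sum_Suc[OF U p x, of k] Suc by simp
qed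

text \<open>This is read off from the last step of the recursion: for \<open>k + 1 = card U\<close>
  the new hook sum is empty and \<open>U\<close> is the only invariant set, so the sign equals the
  hook sum for \<open>card U - 1\<close>.\<close>

lemma sign_cyclic:
  assumes U: "finite U" and x: "x permutes U" and cyc: "cyclic_on x U"
  shows "sign x = (-1) ^ (card U - 1)"
proof -
  obtain p where p: "p \<in> U" using cyc by (auto simp: cyclic_on_def)
  then obtain m where m: "card U = Suc m" using U by (metis card_gt_0_iff empty_iff gr0_implies_Suc)
  have "{S. S \<subseteq> U - {p} \<and> card S = Suc m} = {}"
  proof -
    have "card S \<noteq> Suc m" if "S \<subseteq> U - {p}" for S
      using card_mono[OF _ that] U p m by simp
    then show ?thesis by blast
  qed
  then have "hook_sum U (Suc m) p x = 0" by (simp only: hook_sum_def sum.empty)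
  moreover have "{W. W \<subseteq> U \<and> card W = Suc m \<and> x ` W = W} = {U}"
    using m card_subset_eq[OF U] permutes_image[OF x] by auto
  moreover have "sign_on U x = sign x" using x by (rule sign_on_permutes) simp
  ultimately have "real_of_int (sign x) = (-1) ^ m"
    using hook_sum_Suc[OF U p x, of m] hook_sum_cyclic[OF U p x cyc, of m] m
    by (simp add: invariant_sum_def)
  then show ?thesis using m by (metis diff_Suc_1 of_int_1 of_int_eq_iff of_int_minus of_int_power)
qed

lemma sign_on_cyclic:
  assumes x: "x permutes U" and cyc: "cyclic_on x D"
  shows "sign_on D x = (-1) ^ (card D - 1)"
proof -
  have "restrict_id x D permutes D"
    using x cyclic_on_image_eq[OF cyc permutes_inj[OF x]] by (rule permutes_restrict_id')
  moreover have "cyclic_on (restrict_id x D) D"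
    using cyc cyclic_cong[of D x "restrict_id x D"] by simp
  ultimately show ?thesis
    unfolding sign_on_def using sign_cyclic finite_cyclic_on[OF cyc] by blast
qed

section \<open>Adding a cycle that avoids the base point, and the indicator of full cycles\<close>

context hook
begin

text \<open>\<open>c\<close> fixes \<open>D\<close> pointwise, so the cycle on \<open>D\<close> is
  part of the row factor; it can be split off there and moved into the column factor. If
  \<open>S\<close> is not closed, neither is \<open>S \<union> D\<close>, since \<open>D\<close> is
  invariant.\<close>

lemma hook_sign_Un_cyclic:
  assumes x: "x permutes U" and cyc: "cyclic_on x D" and D: "D \<subseteq> U - insert p S"
  shows "hook_sign U (S \<union> D) p x = hook_sign U S p x * sign_on D x"
proof -
  have xD: "x ` D = D" using cyc permutes_inj[OF x] by (rule cyclic_on_image_eq)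
  interpret SD: hook U "S \<union> D" p
    using finite_U p_in S_sub D by unfold_locales auto
  show ?thesis
  proof (cases "S \<subseteq> x ` insert p S")
    case True
    then obtain r c where f: "hook_factor U S p x r c"
      using factor_iff[OF x] closed_iff[OF x] by blast
    have r: "r permutes (U - S)" and c: "c permutes (insert p S)" and xrc: "x = r \<circ> c"
      using f by (auto simp: hook_factor_def)
    define d where "d = restrict_id x D"
    have d: "d permutes D" unfolding d_def using x xD by (rule permutes_restrict_id')
    have rd: "r y = d y" if "y \<in> D" for y
    proof -
      have "c y = y" using that permutes_not_in[OF c, of y] D by blast
      then show ?thesis using that by (simp add: d_def xrc)
    qed
    have dU: "d permutes U - S" using d by (rule permutes_subset) (use D in blast)
    have "(r \<circ> inv' d) permutes (U - S)" using permutes_inv[OF dU] r by (rule permutes_compose)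
    then have "(r \<circ> inv' d) permutes (U - (S \<union> D))"
    proof (rule permutes_superset)
      fix y assume "y \<in> U - S - (U - (S \<union> D))"
      then have "y \<in> D" by blast
      then have "inv' d y \<in> D" using permutes_in_image[OF permutes_inv[OF d]] by blast
      then show "(r \<circ> inv' d) y = y" using rd permutes_inverses(1)[OF d] by simp
    qed
    moreover have c': "c permutes insert p (S \<union> D)" and d': "d permutes insert p (S \<union> D)"
      using c d by (auto intro: permutes_subset)
    moreover have "x = (r \<circ> inv' d) \<circ> (d \<circ> c)"
      using permutes_inverses(2)[OF d] by (auto simp: xrc fun_eq_iff)
    ultimately have "hook_factor U (S \<union> D) p x (r \<circ> inv' d) (d \<circ> c)"
      by (auto simp: hook_factor_def intro: permutes_compose)
    from SD.hook_sign_eq[OF this] show ?thesis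
      using hook_sign_eq[OF f] SD.sign_compose'[OF d' c'] by (simp add: d_def sign_on_def)
  next
    case False
    then obtain s where s: "s \<in> S" "s \<notin> x ` insert p S" by blast
    have "s \<notin> D" using s D by blast
    then have "s \<notin> x ` insert p (S \<union> D)" using s(2) xD by auto
    then have "\<not> S \<union> D \<subseteq> x ` insert p (S \<union> D)" using s(1) by blast
    then show ?thesis
      using hook_sign_not_closed[OF x False] SD.hook_sign_not_closed[OF x] by simp
  qed
qed

text \<open>Since \<open>D\<close> is invariant and avoids \<open>p\<close>, the part
  \<open>S \<inter> D\<close> is contained in its own image, hence invariant by cardinality, and a
  nonempty invariant part of a cycle is the whole cycle.\<close>

lemma closed_cyclic_subset:
  assumes x: "x permutes U" and cyc: "cyclic_on x D" and p: "p \<notin> D"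
    and S: "S \<subseteq> x ` insert p S" and ne: "S \<inter> D \<noteq> {}"
  shows "D \<subseteq> S"
proof -
  have xD: "x ` D = D" using cyc permutes_inj[OF x] by (rule cyclic_on_image_eq)
  have "S \<inter> D \<subseteq> x ` (S \<inter> D)"
  proof
    fix s assume s: "s \<in> S \<inter> D"
    then obtain y where y: "y \<in> insert p S" "s = x y" using S by blast
    then have "y \<in> D" using s xD inj_image_mem_iff[OF permutes_inj[OF x], of y D] by simp
    then show "s \<in> x ` (S \<inter> D)" using y p by blast
  qed
  then have "S \<inter> D = x ` (S \<inter> D)"
    using finite_S by (intro card_seteq) (auto intro: card_image_le)
  then show ?thesis
    using cyclic_on_invariant_subset[OF cyc, of "S \<inter> D"] ne by blast
qed

end

lemma alternating_hook_sum_Pow: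
  assumes U: "finite U" and p: "p \<in> U"
  shows "(\<Sum>k<card U. (-1) ^ k * hook_sum U k p x)
         = (\<Sum>S\<in>Pow (U - {p}). (-1) ^ card S * hook_sign U S p x)"
proof -
  let ?h = "\<lambda>S. (-1) ^ card S * hook_sign U S p x"
  have "(\<Sum>k<card U. \<Sum>S | S \<in> Pow (U - {p}) \<and> card S = k. ?h S) = sum ?h (Pow (U - {p}))"
  proof (rule sum.group)
    show "card ` Pow (U - {p}) \<subseteq> {..<card U}"
      using U p by (auto intro!: psubset_card_mono)
  qed (use U in auto)
  moreover have "(\<Sum>S | S \<in> Pow (U - {p}) \<and> card S = k. ?h S) = (-1) ^ k * hook_sum U k p x" for k
    by (simp add: hook_sum_def sum_distrib_left)
  ultimately show ?thesis by simp
qed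

text \<open>On a full cycle every term is 1. Otherwise some cycle \<open>D\<close> avoids
  \<open>p\<close>, and the closed sets cancel in pairs \<open>S\<close> and
  \<open>S \<union> D\<close>.\<close>

lemma alternating_hook_sum:
  assumes U: "finite U" and p: "p \<in> U" and x: "x permutes U"
  shows "(\<Sum>k<card U. (-1) ^ k * hook_sum U k p x) = (if cyclic_on x U then card U else 0)"
proof (cases "cyclic_on x U")
  case True
  have "(\<Sum>k<card U. (-1) ^ k * hook_sum U k p x) = (\<Sum>k<card U. 1)"
    using hook_sum_cyclic[OF U p x True] by (intro sum.cong) (auto simp flip: power_mult_distrib)
  then show ?thesis using True by simp
next
  case False
  have "orbit x p \<subseteq> U" using x p by (rule permutes_orbit_subset)
  moreover have "orbit x p \<noteq> U" using False p cyclic_on_singleI by metis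
  ultimately obtain y where y: "y \<in> U" "y \<notin> orbit x p" by blast
  define D where "D = orbit x y"
  have cyc: "cyclic_on x D" unfolding D_def using x U by (rule cyclic_on_orbit)
  have DU: "D \<subseteq> U" unfolding D_def using x y(1) by (rule permutes_orbit_subset)
  have perm: "permutation x" using x U by (auto simp: permutation_permutes)
  have pD: "p \<notin> D"
  proof
    assume "p \<in> D"
    then have "orbit x p = D" by (rule orbit_cyclic_eq3[OF cyc])
    then show False using y(2) permutation_self_in_orbit[OF perm] by (simp add: D_def)
  qed
  define X where "X = U - {p}"
  have D: "D \<subseteq> X" using DU pD by (auto simp: X_def)
  have finX: "finite X" and finD: "finite D" using U finite_subset[OF DU] by (auto simp: X_def)
  have y_D: "y \<in> D" unfolding D_def using perm by (rule permutation_self_in_orbit)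
  have cD: "card D \<noteq> 0" using finD cyc by (auto simp: cyclic_on_def)
  define h where "h S = (-1) ^ card S * hook_sign U S p x" for S
  have hook: "hook U S p" if "S \<in> Pow X" for S
    using that U p by unfold_locales (auto simp: X_def)
  \<comment> \<open>A set that meets \<open>D\<close> without containing it is not closed and
    contributes 0.\<close>
  have "sum h (Pow X) = sum h (Pow (X - D) \<union> (\<lambda>S. S \<union> D) ` Pow (X - D))"
  proof (rule sum.mono_neutral_right)
    show "\<forall>S\<in>Pow X - (Pow (X - D) \<union> (\<lambda>S. S \<union> D) ` Pow (X - D)). h S = 0"
    proof
      fix S assume S: "S \<in> Pow X - (Pow (X - D) \<union> (\<lambda>S. S \<union> D) ` Pow (X - D))"
      interpret hook U S p using hook S by blast
      have "S \<inter> D \<noteq> {}" using S by blast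
      moreover have "\<not> D \<subseteq> S"
      proof
        assume "D \<subseteq> S"
        then have "S = (S - D) \<union> D" by blast
        then show False using S by blast
      qed
      ultimately show "h S = 0"
        using closed_cyclic_subset[OF x cyc pD] hook_sign_not_closed[OF x] by (auto simp: h_def)
    qed
  qed (use finX D in auto)
  also have "\<dots> = sum h (Pow (X - D)) + sum h ((\<lambda>S. S \<union> D) ` Pow (X - D))"
  proof (rule sum.union_disjoint)
    show "Pow (X - D) \<inter> (\<lambda>S. S \<union> D) ` Pow (X - D) = {}" using y_D by blast
  qed (use finX in auto)
  also have "sum h ((\<lambda>S. S \<union> D) ` Pow (X - D)) = (\<Sum>S\<in>Pow (X - D). h (S \<union> D))"
    by (subst sum.reindex) (auto simp: inj_on_def)
  also have "\<dots> = (\<Sum>S\<in>Pow (X - D). - h S)"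
  proof (rule sum.cong[OF refl])
    fix S assume S: "S \<in> Pow (X - D)"
    interpret hook U S p using hook S by blast
    have card: "card (S \<union> D) = card S + card D"
      using S finite_S finD by (intro card_Un_disjoint) auto
    \<comment> \<open>The change in the parity of the cardinality and the sign of a cycle of length
      \<open>card D\<close> have product -1. The truncated subtraction is exact because
      \<open>D\<close> is nonempty.\<close>
    have sgn: "(-1::real) ^ card D * (-1) ^ (card D - 1) = -1"
      using cD by (cases "card D") (auto simp flip: power_mult_distrib)
    have hs: "hook_sign U (S \<union> D) p x = hook_sign U S p x * sign_on D x"
      using S D by (intro hook_sign_Un_cyclic[OF x cyc]) (auto simp: X_def)
    have "h (S \<union> D)
        = (-1) ^ card S * hook_sign U S p x * ((-1) ^ card D * (-1) ^ (card D - 1))"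
      unfolding h_def card hs sign_on_cyclic[OF x cyc] by (simp add: power_add)
    then show "h (S \<union> D) = - h S" unfolding sgn by (simp add: h_def)
  qed
  finally have "sum h (Pow X) = 0" by (simp add: sum_negf)
  then show ?thesis
    using False alternating_hook_sum_Pow[OF U p, of x] by (simp add: h_def X_def)
qed

section \<open>Bounds for hook sums\<close>

text \<open>By \<open>hook_sign_not_closed\<close> these are the only sets that contribute to
  \<open>hook_sum\<close>.\<close>

definition closed_sets :: "'a set \<Rightarrow> nat \<Rightarrow> 'a \<Rightarrow> ('a \<Rightarrow> 'a) \<Rightarrow> 'a set set" where
  "closed_sets U k p x = {S. S \<subseteq> U - {p} \<and> card S = k \<and> S \<subseteq> x ` insert p S}"

lemma closed_iff_inv:
  assumes "x permutes U"
  shows "S \<subseteq> x ` T \<longleftrightarrow> (\<forall>s\<in>S. inv' x s \<in> T)"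
proof -
  have "s \<in> x ` T \<longleftrightarrow> inv' x s \<in> T" for s
    using inj_image_mem_iff[OF permutes_inj[OF assms], of "inv' x s" T] permutes_inverses(1)[OF assms]
    by simp
  then show ?thesis by blast
qed

text \<open>If \<open>T\<close> is closed, an added point \<open>y\<close> is either fixed by
  \<open>x\<close> or the single point of the image of \<open>insert p T\<close> outside
  \<open>T\<close>. If \<open>T\<close> is not closed, some \<open>s\<close> in \<open>T\<close> has
  its preimage outside \<open>insert p T\<close>, and only \<open>y = inv' x s\<close> can repair
  this.\<close>

lemma card_closed_extensions:
  assumes U: "finite U" and p: "p \<in> U" and x: "x permutes U" and T: "T \<subseteq> U - {p}"
  shows "card {y \<in> U - {p} - T. insert y T \<subseteq> x ` insert p (insert y T)}
         \<le> card {y \<in> U - {p}. x y = y} + 1" (is "card ?E \<le> card ?F + 1")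
proof (cases "T \<subseteq> x ` insert p T")
  case True
  have finT: "finite T" using T U by (meson finite_Diff finite_subset)
  have finF: "finite ?F" using U by simp
  have pT: "p \<notin> T" using T by blast
  have "card (x ` insert p T - T) = card (x ` insert p T) - card T"
    using True finT by (intro card_Diff_subset)
  also have "card (x ` insert p T) = card (insert p T)"
    using permutes_inj_on[OF x] by (rule card_image)
  finally have c: "card (x ` insert p T - T) = 1" using pT finT by simp
  have "?E \<subseteq> ?F \<union> (x ` insert p T - T)"
  proof
    fix y assume y: "y \<in> ?E"
    then obtain z where z: "z \<in> insert p (insert y T)" "y = x z" by blast
    show "y \<in> ?F \<union> (x ` insert p T - T)"
    proof (cases "z = y")
      case True
      then show ?thesis using y z(2) by simp
    next
      case False
      then show ?thesis using y z by blast
    qed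
  qed
  then have "card ?E \<le> card (?F \<union> (x ` insert p T - T))"
    using finF finT by (intro card_mono) auto
  also have "\<dots> \<le> card ?F + card (x ` insert p T - T)" by (rule card_Un_le)
  finally show ?thesis using c by simp
next
  case False
  then obtain s where s: "s \<in> T" "inv' x s \<notin> insert p T"
    using closed_iff_inv[OF x] by blast
  have "y = inv' x s" if "y \<in> ?E" for y
  proof -
    have "s \<in> x ` insert p (insert y T)" using that s(1) by blast
    then have "inv' x s \<in> insert p (insert y T)" 
      using closed_iff_inv[OF x, of "{s}" "insert p (insert y T)"] by blast
    then show ?thesis using s(2) by blast
  qed
  then have "?E \<subseteq> {inv' x s}" by blast
  then have "card ?E \<le> card {inv' x s}" by (intro card_mono) auto
  then show ?thesis by simp
qed

text \<open>Double counting of the pairs of a closed set \<open>S\<close> and a point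
  \<open>y\<close> of it: removing \<open>y\<close> leaves a set of size \<open>k - 1\<close>, whose
  closed extensions are bounded by \<open>card_closed_extensions\<close>.\<close>

lemma card_closed_sets_le:
  assumes U: "finite U" and p: "p \<in> U" and x: "x permutes U" and k: "1 \<le> k"
  shows "card (closed_sets U k p x) * (card U - k)
         \<le> (card {y \<in> U - {p}. x y = y} + 1) * ((card U - 1) choose k)"
proof -
  define X where "X = U - {p}"
  define N where "N = card U - 1"
  define f where "f = card {y \<in> X. x y = y} + 1"
  let ?C = "closed_sets U k p x"
  let ?T = "{T. T \<subseteq> X \<and> card T = k - 1}"
  let ?E = "\<lambda>T. {y \<in> X - T. insert y T \<subseteq> x ` insert p (insert y T)}"
  have finX: "finite X" and cX: "card X = N" using U p by (auto simp: X_def N_def)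
  have finT: "finite ?T" using finX by simp
  have C: "S \<subseteq> X" "card S = k" "S \<subseteq> x ` insert p S" if "S \<in> ?C" for S
    using that by (auto simp: closed_sets_def X_def)
  have finC: "finite ?C" using finX by (auto simp: closed_sets_def X_def)
  have finS: "finite S" if "S \<in> ?C" for S using C(1)[OF that] finX finite_subset by blast
  have "card ?C * k = card (SIGMA S:?C. S)"
    using C finS finC by (subst card_SigmaI) auto
  also have "\<dots> \<le> card (SIGMA T:?T. ?E T)"
  proof (rule card_inj_on_le[where f = "\<lambda>(S, y). (S - {y}, y)"])
    show "inj_on (\<lambda>(S, y). (S - {y}, y)) (SIGMA S:?C. S)"
      by (auto simp: inj_on_def)
    show "(\<lambda>(S, y). (S - {y}, y)) ` (SIGMA S:?C. S) \<subseteq> (SIGMA T:?T. ?E T)"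
    proof clarify
      fix S y assume S: "S \<in> ?C" and y: "y \<in> S"
      have "insert y (S - {y}) = S" using y by blast
      then show "S - {y} \<in> ?T \<and> y \<in> ?E (S - {y})"
        using C[OF S] y by (auto simp: card_Diff_singleton simp del: image_insert)
    qed
    show "finite (SIGMA T:?T. ?E T)" using finT finX by auto
  qed
  also have "\<dots> = (\<Sum>T\<in>?T. card (?E T))"
    using finT finX by (intro card_SigmaI) auto
  also have "\<dots> \<le> of_nat (card ?T) * f"
  proof (rule sum_bounded_above)
    fix T assume "T \<in> ?T"
    then show "card (?E T) \<le> f"
      unfolding f_def X_def using card_closed_extensions[OF U p x, of T] by (simp add: X_def)
  qed
  finally have 1: "card ?C * k \<le> (N choose (k - 1)) * f"
    using n_subsets[OF finX, of "k - 1"] cX by simp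
  \<comment> \<open>Passing from \<open>k - 1\<close> to \<open>k\<close> in the binomial
    coefficient brings in exactly the factor \<open>card U - k\<close>.\<close>
  have "k * (N choose k) = (N - (k - 1)) * (N choose (k - 1))"
    using binomial_absorb_comp[of N "k - 1"] Suc_times_binomial_eq[of "N - 1" "k - 1"]
      binomial_absorption[of "k - 1" "N - 1"] k by (cases N) auto
  moreover have "N - (k - 1) = card U - k" using k by (simp add: N_def)
  ultimately have 2: "k * (N choose k) = (card U - k) * (N choose (k - 1))" by simp
  have "k * (card ?C * (card U - k)) = (card ?C * k) * (card U - k)" by simp
  also have "\<dots> \<le> ((N choose (k - 1)) * f) * (card U - k)" using 1 by (rule mult_le_mono1)
  also have "\<dots> = k * (f * (N choose k))" using 2 by (metis mult.assoc mult.commute)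
  finally show ?thesis using k by (simp add: f_def X_def N_def)
qed

text \<open>Complements in \<open>U - {p}\<close> give the bijection: no point of \<open>S\<close>
  has its preimage in the complement exactly if no point of the complement is mapped into
  \<open>S\<close>. This makes the previous bound available with \<open>k\<close> and
  \<open>card U - 1 - k\<close> exchanged.\<close>

lemma card_closed_sets_inv:
  assumes U: "finite U" and p: "p \<in> U" and x: "x permutes U" and k: "k \<le> card U - 1"
  shows "card (closed_sets U k p x) = card (closed_sets U (card U - 1 - k) p (inv' x))"
proof -
  define X where "X = U - {p}"
  have finX: "finite X" and cX: "card X = card U - 1" using U p by (auto simp: X_def)
  have key: "S \<subseteq> x ` insert p S \<longleftrightarrow> X - S \<subseteq> inv' x ` insert p (X - S)" if S: "S \<subseteq> X" for S
  proof -
    have xi: "inv' x permutes U" using x by (rule permutes_inv)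
    have "(\<forall>s\<in>S. inv' x s \<in> insert p S) \<longleftrightarrow> (\<forall>s\<in>S. inv' x s \<notin> X - S)"
      using S permutes_in_image[OF xi] by (auto simp: X_def)
    also have "\<dots> \<longleftrightarrow> (\<forall>z\<in>X - S. x z \<notin> S)"
      using permutes_inverses[OF x] by metis
    also have "\<dots> \<longleftrightarrow> (\<forall>z\<in>X - S. x z \<in> insert p (X - S))"
      using S permutes_in_image[OF x] by (auto simp: X_def)
    finally show ?thesis
      using closed_iff_inv[OF x, of S] closed_iff_inv[OF xi, of "X - S"]
      by (simp only: permutes_inv_inv[OF x])
  qed
  have "bij_betw (\<lambda>S. X - S) (closed_sets U k p x) (closed_sets U (card U - 1 - k) p (inv' x))"
  proof (rule bij_betwI[where g = "\<lambda>S. X - S"])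
    show "(\<lambda>S. X - S) \<in> closed_sets U k p x \<rightarrow> closed_sets U (card U - 1 - k) p (inv' x)"
    proof
      fix S assume S: "S \<in> closed_sets U k p x"
      then have "S \<subseteq> X" "card S = k" "S \<subseteq> x ` insert p S" by (auto simp: closed_sets_def X_def)
      moreover have "card (X - S) = card U - 1 - k"
        using calculation cX finX by (simp add: card_Diff_subset finite_subset)
      ultimately show "X - S \<in> closed_sets U (card U - 1 - k) p (inv' x)"
        using key[of S] unfolding closed_sets_def X_def by blast
    qed
    show "(\<lambda>S. X - S) \<in> closed_sets U (card U - 1 - k) p (inv' x) \<rightarrow> closed_sets U k p x"
    proof
      fix S assume S: "S \<in> closed_sets U (card U - 1 - k) p (inv' x)"
      then have S: "S \<subseteq> X" "card S = card U - 1 - k" "S \<subseteq> inv' x ` insert p S"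
        by (auto simp: closed_sets_def X_def)
      have "X - (X - S) = S" using S(1) by blast
      moreover have "card (X - S) = k"
        using S cX finX k by (simp add: card_Diff_subset finite_subset)
      ultimately show "X - S \<in> closed_sets U k p x"
        using key[of "X - S"] S unfolding closed_sets_def X_def by auto
    qed
  qed (auto simp: closed_sets_def X_def)
  then show ?thesis by (rule bij_betw_same_card)
qed

lemma abs_hook_sum_le_card:
  assumes U: "finite U" and p: "p \<in> U" and x: "x permutes U"
  shows "\<bar>hook_sum U k p x\<bar> \<le> card (closed_sets U k p x)"
proof -
  let ?F = "{S. S \<subseteq> U - {p} \<and> card S = k}"
  have hook: "hook U S p" if "S \<in> ?F" for S using that U p by unfold_locales auto
  have "hook_sum U k p x = (\<Sum>S\<in>closed_sets U k p x. hook_sign U S p x)"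
    unfolding hook_sum_def
  proof (rule sum.mono_neutral_right)
    show "\<forall>S\<in>?F - closed_sets U k p x. hook_sign U S p x = 0"
      using hook.hook_sign_not_closed[OF hook x] unfolding closed_sets_def by blast
  qed (use U in \<open>auto simp: closed_sets_def\<close>)
  also have "\<bar>\<dots>\<bar> \<le> (\<Sum>S\<in>closed_sets U k p x. \<bar>hook_sign U S p x\<bar>)" by (rule sum_abs)
  also have "\<dots> \<le> of_nat (card (closed_sets U k p x)) * 1"
    using hook.abs_hook_sign_le[OF hook] by (intro sum_bounded_above) (auto simp: closed_sets_def)
  finally show ?thesis by simp
qed

text \<open>The bound is applied with \<open>p\<close> replaced by a fixed point of \<open>x\<close>, if there is one.\<close>

lemma abs_hook_sum_le:
  assumes U: "finite U" and p: "p \<in> U" and x: "x permutes U"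
    and k: "1 \<le> k" "k < card U - 1"
  shows "\<bar>hook_sum U k p x\<bar> * real (max (k + 1) (card U - k))
         \<le> real (max 1 (card {y \<in> U. x y = y})) * real ((card U - 1) choose k)"
proof -
  define l where "l = card {y \<in> U. x y = y}"
  \<comment> \<open>Fixed points are counted without the base point: with a fixed point as base the
    count is \<open>l - 1\<close>, and without fixed points it is 0, so the extra 1 yields
    \<open>max 1 l\<close> in both cases.\<close>
  obtain q where q: "q \<in> U" "card {y \<in> U - {q}. x y = y} + 1 = max 1 l"
  proof (cases "{y \<in> U. x y = y} = {}")
    case True
    then have e: "{y \<in> U - {p}. x y = y} = {}" by blast
    have "card {y \<in> U - {p}. x y = y} + 1 = max 1 l" unfolding l_def True e by simp
    then show thesis by (rule that[OF p])
  next
    case False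
    then obtain q where q: "q \<in> U" "x q = q" by blast
    have "{y \<in> U. x y = y} = insert q {y \<in> U - {q}. x y = y}" using q by blast
    then have "l = Suc (card {y \<in> U - {q}. x y = y})" using U by (simp add: l_def)
    then have "card {y \<in> U - {q}. x y = y} + 1 = max 1 l" by simp
    then show thesis by (rule that[OF q(1)])
  qed
  let ?c = "card (closed_sets U k q x)"
  have 1: "?c * (card U - k) \<le> max 1 l * ((card U - 1) choose k)"
    using card_closed_sets_le[OF U q(1) x k(1)] by (simp only: q(2))
  have fixed_inv: "{y \<in> U - {q}. inv' x y = y} = {y \<in> U - {q}. x y = y}"
    using permutes_inv_eq[OF x] by auto
  have k': "1 \<le> card U - 1 - k" "card U - (card U - 1 - k) = k + 1" "k \<le> card U - 1"
    using k by auto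
  \<comment> \<open>The same bound for the inverse and the complementary size, where the factor
    becomes \<open>k + 1\<close>.\<close>
  have 2: "?c * (k + 1) \<le> max 1 l * ((card U - 1) choose k)"
    using card_closed_sets_le[OF U q(1) permutes_inv[OF x] k'(1)]
    by (simp only: fixed_inv q(2) k'(2) card_closed_sets_inv[OF U q(1) x k'(3)]
        binomial_symmetric[OF k'(3)])
  have 3: "?c * max (k + 1) (card U - k) \<le> max 1 l * ((card U - 1) choose k)"
    using 1 2 by (auto simp: max_def)
  have "\<bar>hook_sum U k p x\<bar> * real (max (k + 1) (card U - k)) \<le> real ?c * real (max (k + 1) (card U - k))"
    using abs_hook_sum_le_card[OF U q(1) x, of k] hook_sum_indep[OF U p q(1) x, of k]
    by (intro mult_right_mono) auto
  also have "\<dots> = real (?c * max (k + 1) (card U - k))" by simp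
  also have "\<dots> \<le> real (max 1 l * ((card U - 1) choose k))" using 3 by (simp only: of_nat_le_iff)
  finally show ?thesis by (simp add: l_def)
qed

lemma abs_hook_sum_le_choose:
  assumes U: "finite U" and p: "p \<in> U" and x: "x permutes U"
  shows "\<bar>hook_sum U k p x\<bar> \<le> real ((card U - 1) choose k)"
proof -
  have "card (closed_sets U k p x) \<le> card {S. S \<subseteq> U - {p} \<and> card S = k}"
    using U by (intro card_mono) (auto simp: closed_sets_def)
  also have "\<dots> = (card U - 1) choose k" using n_subsets[of "U - {p}" k] U p by simp
  finally show ?thesis using abs_hook_sum_le_card[OF U p x, of k] by linarith
qed

section \<open>Collision counts\<close>

text \<open>For \<open>k \<ge> 1\<close> the column contains a transposition of \<open>p\<close>
  with a point of \<open>S\<close>; right multiplication by it permutes the group and reverses every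
  sign.\<close>

lemma hook_sum_zero_average:
  assumes U: "finite U" and p: "p \<in> U" and k: "1 \<le> k"
  shows "(\<Sum>x | x permutes U. hook_sum U k p x) = 0"
proof -
  have "(\<Sum>x | x permutes U. hook_sum U k p x)
      = (\<Sum>S | S \<subseteq> U - {p} \<and> card S = k. \<Sum>x | x permutes U. hook_sign U S p x)"
    unfolding hook_sum_def by (rule sum.swap)
  also have "\<dots> = 0"
  proof (rule sum.neutral, rule ballI)
    fix S assume "S \<in> {S. S \<subseteq> U - {p} \<and> card S = k}"
    then have S: "S \<subseteq> U - {p}" "card S = k" by auto
    interpret hook U S p using U p S by unfold_locales auto
    obtain a where a: "a \<in> S" using S k by fastforce
    have ap: "a \<noteq> p" "a \<in> U" using a S by auto
    define t where "t = Transposition.transpose a p"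
    have t: "t permutes insert p S" using a by (auto simp: t_def intro: permutes_swap_id)
    have tU: "t permutes U" using ap p by (auto simp: t_def intro: permutes_swap_id)
    have "(\<Sum>x | x permutes U. hook_sign U S p x) = (\<Sum>x | x permutes U. hook_sign U S p (x \<circ> t))"
      by (rule sum.reindex_bij_witness[where i = "\<lambda>x. x \<circ> t" and j = "\<lambda>x. x \<circ> t"])
        (use permutes_compose[OF tU] in \<open>auto simp: t_def comp_assoc\<close>)
    also have "\<dots> = (\<Sum>x | x permutes U. - hook_sign U S p x)"
      using hook_sign_mult[OF permutes_id t] ap by (simp add: t_def sign_swap_id)
    finally show "(\<Sum>x | x permutes U. hook_sign U S p x) = 0" by (simp add: sum_negf)
  qed
  finally show ?thesis .
qed

definition full_cycles :: "'a set \<Rightarrow> ('a \<Rightarrow> 'a) set" where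
  "full_cycles U = {x. x permutes U \<and> cyclic_on x U}"

text \<open>Summing the indicator formula \<open>alternating_hook_sum\<close> over the whole group
  leaves only the term \<open>k = 0\<close>, which contributes 1 for each permutation.\<close>

lemma card_full_cycles:
  assumes U: "finite U" "U \<noteq> {}"
  shows "card U * card (full_cycles U) = fact (card U)"
proof -
  obtain p where p: "p \<in> U" using U by blast
  let ?G = "{x. x permutes U}"
  have finG: "finite ?G" using U by (simp add: finite_permutations)
  obtain m where m: "card U = Suc m" using U by (metis card_eq_0_iff not0_implies_Suc)
  have "full_cycles U = {x \<in> ?G. cyclic_on x U}" by (auto simp: full_cycles_def)
  then have "real (card U * card (full_cycles U)) = (\<Sum>x\<in>?G. if cyclic_on x U then card U else 0)"
    using finG by (simp add: sum.If_cases Int_def)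
  also have "\<dots> = (\<Sum>x\<in>?G. \<Sum>k<card U. (-1) ^ k * hook_sum U k p x)"
    using alternating_hook_sum[OF U(1) p] by (simp add: of_nat_sum)
  also have "\<dots> = (\<Sum>k<card U. (-1) ^ k * (\<Sum>x\<in>?G. hook_sum U k p x))"
    by (subst sum.swap) (simp add: sum_distrib_left)
  also have "\<dots> = (\<Sum>x\<in>?G. hook_sum U 0 p x)"
    unfolding m sum.lessThan_Suc_shift using hook_sum_zero_average[OF U(1) p] by simp
  also have "\<dots> = real (card ?G)" using hook_sum_0[OF U(1) p] by simp
  also have "card ?G = fact (card U)" using U by (simp add: card_permutations)
  finally show ?thesis by (simp only: of_nat_eq_iff)
qed

lemma conj_closed_inv:
  assumes K: "conj_closed U K"
  shows "conj_closed U (inv' ` K)"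
proof -
  have "h \<circ> inv' x \<circ> inv' h \<in> inv' ` K" if h: "h permutes U" and x: "x \<in> K" for h x
  proof
    have xU: "x permutes U" using K x by (auto simp: conj_closed_def)
    show "h \<circ> x \<circ> inv' h \<in> K" using K h x by (auto simp: conj_closed_def)
    show "h \<circ> inv' x \<circ> inv' h = inv' (h \<circ> x \<circ> inv' h)"
      using permutes_bij[OF h] permutes_bij[OF xU] permutes_bij[OF permutes_inv[OF h]]
      by (simp add: o_inv_distrib bij_comp inv_inv_eq comp_assoc)
  qed
  then show ?thesis using K permutes_inv unfolding conj_closed_def by blast
qed

text \<open>With \<open>m\<close> half of \<open>N\<close> rounded up, the maximum is
  \<open>k + 1\<close> for \<open>k \<ge> m\<close> and \<open>N + 1 - k\<close> for smaller
  \<open>k\<close>, so reflection in \<open>N - k\<close> reduces the sum to two copies of its upper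
  half. There \<open>1 / (k + 1)^2\<close> is below the telescoping difference
  \<open>1 / k - 1 / (k + 1)\<close>, and the total from \<open>m\<close> on is
  \<open>1 / m - 1 / N\<close>, which is at most \<open>1 / N\<close>.\<close>

lemma sum_inverse_square_max_le:
  assumes "1 \<le> N"
  shows "(\<Sum>k = 1..<N. 1 / (real (max (k + 1) (N + 1 - k)))\<^sup>2) \<le> 2 / real N"
proof -
  define m where "m = (N + 1) div 2"
  have m: "1 \<le> m" "m \<le> N" "N \<le> 2 * m" using assms by (auto simp: m_def)
  define g where "g k = (if m \<le> k then 1 / real k - 1 / real (Suc k) else 0)" for k
  have gle: "1 / (real (Suc k))\<^sup>2 \<le> g k" if "m \<le> k" for k
  proof -
    have "real k > 0" using that m by simp
    then have "g k = 1 / (real k * real (Suc k))" using that by (simp add: g_def field_simps)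
    moreover have "1 / (real (Suc k))\<^sup>2 \<le> 1 / (real k * real (Suc k))"
      using \<open>real k > 0\<close> by (intro frac_le) (auto simp: power2_eq_square)
    ultimately show ?thesis by simp
  qed
  have g0: "0 \<le> g k" for k using m by (auto simp: g_def field_simps)
  have "(\<Sum>k = 1..<N. g k) = (\<Sum>k = m..<N. 1 / real k - 1 / real (Suc k))"
    using m by (intro sum.mono_neutral_cong_right) (auto simp: g_def)
  also have "\<dots> = 1 / real m - 1 / real N"
    using sum_Suc_diff'[OF m(2), of "\<lambda>k. - (1 / real k)"] by simp
  also have "\<dots> \<le> 2 / real N - 1 / real N"
    using m by (simp add: field_simps)
  finally have G: "(\<Sum>k = 1..<N. g k) \<le> 1 / real N" by simp
  have "(\<Sum>k = 1..<N. 1 / (real (max (k + 1) (N + 1 - k)))\<^sup>2) \<le> (\<Sum>k = 1..<N. g k + g (N - k))"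
  proof (rule sum_mono)
    fix k assume k: "k \<in> {1..<N}"
    show "1 / (real (max (k + 1) (N + 1 - k)))\<^sup>2 \<le> g k + g (N - k)"
    proof (cases "m \<le> k")
      case True
      then have "max (k + 1) (N + 1 - k) = Suc k" using m by auto
      then show ?thesis using gle[OF True] g0[of "N - k"] by simp
    next
      case False
      then have "m \<le> N - k" "max (k + 1) (N + 1 - k) = Suc (N - k)" 
        using k by (auto simp: m_def)
      then show ?thesis using gle[of "N - k"] g0[of k] by simp
    qed
  qed
  also have "\<dots> = (\<Sum>k = 1..<N. g k) + (\<Sum>k = 1..<N. g (N - k))" by (rule sum.distrib)
  also have "(\<Sum>k = 1..<N. g (N - k)) = (\<Sum>k = 1..<N. g k)"
    by (rule sum.reindex_bij_witness[where i = "\<lambda>k. N - k" and j = "\<lambda>k. N - k"]) auto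
  finally show ?thesis using G by simp
qed

text \<open>\<open>hook_sum_mult\<close> is used twice, first to average over \<open>z\<close> and
  then over \<open>y\<close>; what remains is the hook sum at a full cycle, which is
  \<open>(-1) ^ k\<close>.\<close>

lemma sum_triple_hook_sum:
  assumes U: "finite U" and p: "p \<in> U" and K: "conj_closed U K" and k: "k < card U"
  shows "(real ((card U - 1) choose k))\<^sup>2
      * (\<Sum>x\<in>full_cycles U. \<Sum>y\<in>K. \<Sum>z\<in>inv' ` K. hook_sum U k p (x \<circ> y \<circ> z))
    = real (card (full_cycles U)) * (-1) ^ k * (\<Sum>y\<in>K. hook_sum U k p y) * (\<Sum>z\<in>inv' ` K. hook_sum U k p z)"
proof -
  let ?B = "real ((card U - 1) choose k)"
  let ?C = "full_cycles U"
  let ?a = "\<Sum>y\<in>K. hook_sum U k p y" and ?b = "\<Sum>z\<in>inv' ` K. hook_sum U k p z"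
  have CU: "x permutes U" if "x \<in> ?C" for x using that by (simp add: full_cycles_def)
  have KU: "y permutes U" if "y \<in> K" for y using that K by (simp add: conj_closed_def)
  have "?B\<^sup>2 * (\<Sum>x\<in>?C. \<Sum>y\<in>K. \<Sum>z\<in>inv' ` K. hook_sum U k p (x \<circ> y \<circ> z))
      = ?B * (\<Sum>x\<in>?C. \<Sum>y\<in>K. ?B * (\<Sum>z\<in>inv' ` K. hook_sum U k p (x \<circ> y \<circ> z)))"
    by (simp add: power2_eq_square sum_distrib_left mult.assoc)
  also have "\<dots> = ?B * (\<Sum>x\<in>?C. \<Sum>y\<in>K. hook_sum U k p (x \<circ> y) * ?b)"
    using hook_sum_mult[OF U p conj_closed_inv[OF K]] CU KU permutes_compose
    by (intro arg_cong[where f = "\<lambda>s. ?B * s"] sum.cong refl) blast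
  also have "\<dots> = (\<Sum>x\<in>?C. ?B * (\<Sum>y\<in>K. hook_sum U k p (x \<circ> y))) * ?b"
    by (simp only: sum_distrib_right[symmetric] sum_distrib_left[symmetric] mult.assoc)
  also have "\<dots> = (\<Sum>x\<in>?C. hook_sum U k p x * ?a) * ?b"
    using hook_sum_mult[OF U p K] CU by (intro arg_cong[where f = "\<lambda>s. s * ?b"] sum.cong refl) blast
  also have "\<dots> = (\<Sum>x\<in>?C. (-1) ^ k * ?a) * ?b"
    using hook_sum_cyclic[OF U p _ _ k] 
    by (intro arg_cong[where f = "\<lambda>s. s * ?b"] sum.cong refl) (simp add: full_cycles_def)
  finally show ?thesis by (simp add: mult_ac)
qed

text \<open>The triple sum counts the coincidences between two products of a full cycle with an
  element of \<open>K\<close>. Membership in \<open>full_cycles U\<close> is expanded by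
  \<open>alternating_hook_sum\<close>, and \<open>sum_triple_hook_sum\<close> evaluates each term.
  In the final factor the two end terms account for 2 and the inner ones for the fraction.\<close>

lemma card_triples_full_cycles_le:
  assumes U: "finite U" and n: "2 \<le> card U" and K: "conj_closed U K"
    and fixed: "\<And>x. x \<in> K \<Longrightarrow> card {y \<in> U. x y = y} = l"
  defines "N \<equiv> real (card U - 1)" and "L \<equiv> real (max 1 l)"
  shows "real (card U) * (\<Sum>x\<in>full_cycles U. \<Sum>y\<in>K. \<Sum>z\<in>K.
      if x \<circ> y \<circ> inv' z \<in> full_cycles U then 1 else 0)
    \<le> card (full_cycles U) * (real (card K))\<^sup>2 * (2 + 2 * L\<^sup>2 / N)"
proof -
  let ?C = "full_cycles U"
  obtain p where p: "p \<in> U" using n by fastforce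
  define M where "M = card U - 1"
  have M: "1 \<le> M" "card U = Suc M" using n by (auto simp: M_def)
  define B where "B k = real (M choose k)" for k
  define a where "a k = (\<Sum>y\<in>K. hook_sum U k p y)" for k
  define b where "b k = (\<Sum>z\<in>inv' ` K. hook_sum U k p z)" for k
  define T where "T k = (\<Sum>x\<in>?C. \<Sum>y\<in>K. \<Sum>z\<in>inv' ` K. hook_sum U k p (x \<circ> y \<circ> z))" for k
  have CU: "x permutes U" if "x \<in> ?C" for x using that by (simp add: full_cycles_def)
  have KU: "y permutes U" if "y \<in> K" for y using that K by (simp add: conj_closed_def)
  have inj: "inj_on inv' K" using KU permutes_inv_inv by (metis inj_on_inverseI)
  have fixed': "card {y \<in> U. inv' x y = y} = l" if "x \<in> K" for x
  proof -
    have "{y \<in> U. inv' x y = y} = {y \<in> U. x y = y}"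
      using permutes_inv_eq[OF KU[OF that]] by auto
    then show ?thesis using fixed[OF that] by simp
  qed
  have Bpos: "B k > 0" if "k \<le> M" for k using that by (simp add: B_def)
  have sum_bound: "\<bar>\<Sum>y\<in>K'. hook_sum U k p y\<bar> \<le> card K * c"
    if "\<And>y. y \<in> K' \<Longrightarrow> \<bar>hook_sum U k p y\<bar> \<le> c" "card K' = card K" for K' k and c :: real
    using order_trans[OF sum_abs sum_bounded_above[of K' "\<lambda>y. \<bar>hook_sum U k p y\<bar>" c]] that by simp
  have ab: "\<bar>a k\<bar> \<le> card K * c" "\<bar>b k\<bar> \<le> card K * c"
    if "\<And>x. x permutes U \<Longrightarrow> card {y \<in> U. x y = y} = l \<Longrightarrow> \<bar>hook_sum U k p x\<bar> \<le> c" for k and c :: real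
  proof -
    show "\<bar>a k\<bar> \<le> card K * c" unfolding a_def using that KU fixed by (intro sum_bound) auto
    have "\<bar>hook_sum U k p (inv' x)\<bar> \<le> c" if x: "x \<in> K" for x
      using \<open>\<And>x. x permutes U \<Longrightarrow> card {y \<in> U. x y = y} = l \<Longrightarrow> \<bar>hook_sum U k p x\<bar> \<le> c\<close>
        permutes_inv[OF KU[OF x]] fixed'[OF x] by blast
    then show "\<bar>b k\<bar> \<le> card K * c"
      unfolding b_def using card_image[OF inj] by (intro sum_bound) auto
  qed
  have prod_bound: "a k * b k \<le> (card K * c)\<^sup>2"
    if "\<And>x. x permutes U \<Longrightarrow> card {y \<in> U. x y = y} = l \<Longrightarrow> \<bar>hook_sum U k p x\<bar> \<le> c" for k and c :: real
  proof -
    have "a k * b k \<le> \<bar>a k\<bar> * \<bar>b k\<bar>" by (simp flip: abs_mult)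
    also have "\<dots> \<le> (card K * c) * (card K * c)"
      using ab[OF that] by (intro mult_mono) auto
    finally show ?thesis by (simp add: power2_eq_square)
  qed
  \<comment> \<open>The sign of the expansion cancels against the hook sum of the full
    cycles.\<close>
  have T: "(-1) ^ k * T k = real (card ?C) * (a k * b k / (B k)\<^sup>2)" if "k \<le> M" for k
  proof -
    have "(B k)\<^sup>2 * T k = real (card ?C) * (-1) ^ k * a k * b k"
      using sum_triple_hook_sum[OF U p K, of k] that M
      by (simp add: B_def T_def a_def b_def)
    then have "T k = real (card ?C) * (-1) ^ k * (a k * b k) / (B k)\<^sup>2"
      using Bpos[OF that] by (simp add: field_simps)
    then show ?thesis by (simp flip: power_mult_distrib)
  qed
  \<comment> \<open>The trivial bound by the number of \<open>k\<close>-sets; it is applied to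
    \<open>k = 0\<close> and \<open>k = M\<close>.\<close>
  have edge: "a k * b k / (B k)\<^sup>2 \<le> (real (card K))\<^sup>2" if "k \<le> M" for k
    using prod_bound[of k "B k"] abs_hook_sum_le_choose[OF U p, of _ k] Bpos[OF that] M(2)
    by (simp add: B_def field_simps power_mult_distrib)
  have inner: "a k * b k / (B k)\<^sup>2 \<le> (real (card K))\<^sup>2 * L\<^sup>2 * (1 / (real (max (k + 1) (M + 1 - k)))\<^sup>2)"
    if k: "k \<in> {1..<M}" for k
  proof -
    define w where "w = real (max (k + 1) (M + 1 - k))"
    have w: "w > 0" by (simp add: w_def)
    have "\<bar>hook_sum U k p x\<bar> \<le> L * B k / w" 
      if "x permutes U" "card {y \<in> U. x y = y} = l" for x
      using abs_hook_sum_le[OF U p that(1), of k] that(2) k M w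
      by (simp add: L_def B_def w_def field_simps)
    then have "a k * b k \<le> (card K * (L * B k / w))\<^sup>2" by (rule prod_bound)
    also have "\<dots> = (real (card K))\<^sup>2 * L\<^sup>2 * (1 / w\<^sup>2) * (B k)\<^sup>2"
      by (simp add: power_mult_distrib power_divide)
    finally show ?thesis using Bpos[of k] k unfolding w_def by (simp add: divide_le_eq)
  qed
  have "real (card U) * (\<Sum>x\<in>?C. \<Sum>y\<in>K. \<Sum>z\<in>K. if x \<circ> y \<circ> inv' z \<in> ?C then 1 else 0)
      = (\<Sum>x\<in>?C. \<Sum>y\<in>K. \<Sum>z\<in>K. if x \<circ> y \<circ> inv' z \<in> ?C then real (card U) else 0)"
    by (simp add: sum_distrib_left if_distrib cong: if_cong)
  also have "\<dots> = (\<Sum>x\<in>?C. \<Sum>y\<in>K. \<Sum>z\<in>inv' ` K. if x \<circ> y \<circ> z \<in> ?C then real (card U) else 0)"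
    by (simp add: sum.reindex[OF inj])
  also have "\<dots> = (\<Sum>x\<in>?C. \<Sum>y\<in>K. \<Sum>z\<in>inv' ` K. \<Sum>k\<le>M. (-1) ^ k * hook_sum U k p (x \<circ> y \<circ> z))"
  proof (intro sum.cong refl)
    fix x y z assume "x \<in> ?C" "y \<in> K" "z \<in> inv' ` K"
    then have g: "x \<circ> y \<circ> z permutes U"
      using CU KU by (auto intro!: permutes_compose permutes_inv)
    show "(if x \<circ> y \<circ> z \<in> ?C then real (card U) else 0)
        = (\<Sum>k\<le>M. (-1) ^ k * hook_sum U k p (x \<circ> y \<circ> z))"
      using alternating_hook_sum[OF U p g] g M(2) by (simp add: full_cycles_def lessThan_Suc_atMost)
  qed
  also have "\<dots> = (\<Sum>k\<le>M. (-1) ^ k * T k)"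
    unfolding T_def sum_distrib_left by (simp only: sum.swap[where A = "{..M}"])
  also have "\<dots> = card ?C * (\<Sum>k\<le>M. a k * b k / (B k)\<^sup>2)"
    using T by (simp add: sum_distrib_left)
  also have "\<dots> \<le> card ?C * ((real (card K))\<^sup>2 * (2 + 2 * L\<^sup>2 / N))"
  proof (rule mult_left_mono)
    have "{..M} = insert 0 (insert M {1..<M})" using M by auto
    then have "(\<Sum>k\<le>M. a k * b k / (B k)\<^sup>2)
        = a 0 * b 0 / (B 0)\<^sup>2 + (a M * b M / (B M)\<^sup>2 + (\<Sum>k = 1..<M. a k * b k / (B k)\<^sup>2))"
      using M(1) by simp
    also have "\<dots> \<le> (real (card K))\<^sup>2 + ((real (card K))\<^sup>2
        + (\<Sum>k = 1..<M. (real (card K))\<^sup>2 * L\<^sup>2 * (1 / (real (max (k + 1) (M + 1 - k)))\<^sup>2)))"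
      using inner by (intro add_mono edge sum_mono) auto
    also have "\<dots> = (real (card K))\<^sup>2 * (2 + L\<^sup>2 * (\<Sum>k = 1..<M. 1 / (real (max (k + 1) (M + 1 - k)))\<^sup>2))"
      by (simp add: sum_distrib_left algebra_simps)
    also have "\<dots> \<le> (real (card K))\<^sup>2 * (2 + L\<^sup>2 * (2 / real M))"
      using sum_inverse_square_max_le[OF M(1)] by (intro mult_left_mono add_left_mono) auto
    finally show "(\<Sum>k\<le>M. a k * b k / (B k)\<^sup>2) \<le> (real (card K))\<^sup>2 * (2 + 2 * L\<^sup>2 / N)"
      using M(2) by (simp add: N_def mult.commute)
  qed simp
  finally show ?thesis by (simp add: mult.assoc)
qed

section \<open>Total variation distance\<close>

text \<open>A pair of factorizations of the same \<open>g\<close>, with second factors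
  \<open>y\<close> and \<open>z\<close>, is determined by the first factor \<open>x\<close> of one
  of them together with \<open>y\<close> and \<open>z\<close>; the remaining factor is
  \<open>x \<circ> y \<circ> inv' z\<close> and has to lie in \<open>C\<close>.\<close>

lemma sum_card_factorizations_squared:
  assumes U: "finite U" and C: "\<And>x. x \<in> C \<Longrightarrow> x permutes U" and K: "\<And>x. x \<in> K \<Longrightarrow> x permutes U"
  shows "(\<Sum>g | g permutes U. (real (card {(x, y) \<in> C \<times> K. x \<circ> y = g}))\<^sup>2)
    = (\<Sum>x\<in>C. \<Sum>y\<in>K. \<Sum>z\<in>K. if x \<circ> y \<circ> inv' z \<in> C then 1 else 0)"
proof -
  define m where "m g = real (card {(x, y) \<in> C \<times> K. x \<circ> y = g})" for g
  have finG: "finite {g. g permutes U}" using U by (simp add: finite_permutations)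
  have fin: "finite C" "finite K"
    using finite_subset[OF _ finG, of C] finite_subset[OF _ finG, of K] C K by auto
  have m: "m g = (\<Sum>z\<in>K. if g \<circ> inv' z \<in> C then 1 else 0)" for g
  proof -
    have "bij_betw snd {(x, y) \<in> C \<times> K. x \<circ> y = g} {z \<in> K. g \<circ> inv' z \<in> C}"
    proof (rule bij_betwI[where g = "\<lambda>z. (g \<circ> inv' z, z)"])
      show "snd \<in> {(x, y) \<in> C \<times> K. x \<circ> y = g} \<rightarrow> {z \<in> K. g \<circ> inv' z \<in> C}"
        using permutes_inv_o(1)[OF K] by (auto simp: comp_assoc)
      show "(\<lambda>z. (g \<circ> inv' z, z)) \<in> {z \<in> K. g \<circ> inv' z \<in> C} \<rightarrow> {(x, y) \<in> C \<times> K. x \<circ> y = g}"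
        using permutes_inv_o(2)[OF K] by (auto simp: comp_assoc)
    qed (use permutes_inv_o(1)[OF K] in \<open>auto simp: comp_assoc\<close>)
    then have "m g = real (card {z \<in> K. g \<circ> inv' z \<in> C})"
      unfolding m_def by (simp add: bij_betw_same_card)
    then show ?thesis using fin by (simp add: sum.If_cases Int_def)
  qed
  \<comment> \<open>One of the two factors \<open>m g\<close> is written as a sum over the pairs
    with product \<open>g\<close>; the other is kept as a weight.\<close>
  have "(\<Sum>g | g permutes U. (m g)\<^sup>2)
      = (\<Sum>g | g permutes U. \<Sum>w | w \<in> C \<times> K \<and> fst w \<circ> snd w = g. m (fst w \<circ> snd w))"
  proof (rule sum.cong[OF refl])
    fix g
    have "{w. w \<in> C \<times> K \<and> fst w \<circ> snd w = g} = {(x, y) \<in> C \<times> K. x \<circ> y = g}" by auto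
    moreover have "(\<Sum>w | w \<in> C \<times> K \<and> fst w \<circ> snd w = g. m (fst w \<circ> snd w))
        = (\<Sum>w | w \<in> C \<times> K \<and> fst w \<circ> snd w = g. m g)"
      by (intro sum.cong) auto
    ultimately show "(m g)\<^sup>2 = (\<Sum>w | w \<in> C \<times> K \<and> fst w \<circ> snd w = g. m (fst w \<circ> snd w))"
      by (simp add: m_def power2_eq_square)
  qed
  also have "\<dots> = (\<Sum>w\<in>C \<times> K. m (fst w \<circ> snd w))"
  proof (rule sum.group)
    have "x \<circ> y permutes U" if "x \<in> C" "y \<in> K" for x y
      using K[OF that(2)] C[OF that(1)] by (rule permutes_compose)
    then show "(\<lambda>w. fst w \<circ> snd w) ` (C \<times> K) \<subseteq> {g. g permutes U}" by auto
  qed (use fin finG in auto)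
  also have "\<dots> = (\<Sum>x\<in>C. \<Sum>y\<in>K. m (x \<circ> y))"
    by (simp add: sum.cartesian_product case_prod_beta)
  finally show ?thesis unfolding m m_def[symmetric] .
qed

text \<open>\<open>P\<close> has total mass 1 on \<open>X\<close>, so its squared Euclidean distance
  from the uniform distribution is the collision probability minus \<open>1 / card X\<close>.
  Cauchy-Schwarz passes from there to the sum of absolute values.\<close>

lemma tv_dist_uniform_le:
  assumes G: "finite G" and X: "X \<subseteq> G" "X \<noteq> {}" and P: "set_pmf P \<subseteq> X"
    and le: "card X * (\<Sum>g\<in>G. (pmf P g)\<^sup>2) \<le> 1 + e"
  shows "tv_dist G P (pmf_of_set X) \<le> sqrt e / 2"
proof -
  have finX: "finite X" using X G finite_subset by blast
  define q where "q = 1 / real (card X)"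
  have cX: "real (card X) > 0" using X finX by (simp add: card_gt_0_iff)
  have Q: "pmf (pmf_of_set X) g = (if g \<in> X then q else 0)" for g
    using X finX by (simp add: q_def indicator_def)
  have P0: "pmf P g = 0" if "g \<notin> X" for g using that P by (meson pmf_eq_0_set_pmf subsetD)
  have sumP: "(\<Sum>g\<in>X. pmf P g) = 1" using P finX by (rule sum_pmf_eq_1[rotated])
  define D where "D = (\<Sum>g\<in>G. \<bar>pmf P g - pmf (pmf_of_set X) g\<bar>)"
  have D: "D = (\<Sum>g\<in>X. \<bar>pmf P g - q\<bar>)"
    unfolding D_def using G X P0 Q by (intro sum.mono_neutral_cong_right) auto
  have "D\<^sup>2 \<le> card X * (\<Sum>g\<in>X. (pmf P g - q)\<^sup>2)"
    using sum_squared_le_sum_of_squares[of "\<lambda>g. \<bar>pmf P g - q\<bar>" X] by (simp add: D mult.commute)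
  also have "(\<Sum>g\<in>X. (pmf P g - q)\<^sup>2) = (\<Sum>g\<in>X. (pmf P g)\<^sup>2) - 2 * q * (\<Sum>g\<in>X. pmf P g) + card X * q\<^sup>2"
    by (simp add: power2_diff sum.distrib sum_subtractf sum_distrib_left mult_ac)
  also have "card X * \<dots> = card X * (\<Sum>g\<in>X. (pmf P g)\<^sup>2) - 1"
    using cX by (simp add: sumP q_def field_simps power2_eq_square)
  also have "(\<Sum>g\<in>X. (pmf P g)\<^sup>2) = (\<Sum>g\<in>G. (pmf P g)\<^sup>2)"
    using G X P0 by (intro sum.mono_neutral_left) auto
  finally have "D\<^sup>2 \<le> e" using le by simp
  then have "D \<le> sqrt e" by (rule real_le_rsqrt)
  then show ?thesis by (simp add: tv_dist_def D_def)
qed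

lemma pmf_product_of_sets:
  fixes C K :: "('a \<Rightarrow> 'a) set"
  assumes "finite C" "finite K" "C \<noteq> {}" "K \<noteq> {}"
  shows "pmf (map_pmf (\<lambda>(x, y). x \<circ> y) (pair_pmf (pmf_of_set C) (pmf_of_set K))) g
    = card {(x, y) \<in> C \<times> K. x \<circ> y = g} / (real (card C) * real (card K))"
proof -
  have "(C \<times> K) \<inter> (\<lambda>(x, y). x \<circ> y) -` {g} = {(x, y) \<in> C \<times> K. x \<circ> y = g}" by auto
  moreover have "pair_pmf (pmf_of_set C) (pmf_of_set K) = pmf_of_set (C \<times> K)"
  proof (rule pmf_eqI)
    fix w :: "('a \<Rightarrow> 'a) \<times> ('a \<Rightarrow> 'a)"
    show "pmf (pair_pmf (pmf_of_set C) (pmf_of_set K)) w = pmf (pmf_of_set (C \<times> K)) w"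
      using assms by (cases w) (simp add: pmf_pair indicator_def card_cartesian_product)
  qed
  ultimately show ?thesis
    using assms by (simp add: pmf_map measure_pmf_of_set card_cartesian_product)
qed

text \<open>\<open>X\<close> stands for either coset of the alternating group; only its size and the
  fact that all products land in it enter. Since \<open>card X\<close> is half the group order, the
  2 from the end terms of \<open>card_triples_full_cycles_le\<close> becomes the 1 required by
  \<open>tv_dist_uniform_le\<close>.\<close>

lemma tv_dist_full_cycles_product_le:
  assumes U: "finite U" and n: "2 \<le> card U" and K: "conj_closed U K" "K \<noteq> {}"
    and fixed: "\<And>x. x \<in> K \<Longrightarrow> card {y \<in> U. x y = y} = l"
    and X: "X \<subseteq> {g. g permutes U}" "2 * card X = fact (card U)"
    and prod: "\<And>x y. x \<in> full_cycles U \<Longrightarrow> y \<in> K \<Longrightarrow> x \<circ> y \<in> X"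
  shows "tv_dist {g. g permutes U}
      (map_pmf (\<lambda>(x, y). x \<circ> y) (pair_pmf (pmf_of_set (full_cycles U)) (pmf_of_set K))) (pmf_of_set X)
    \<le> real (max 1 l) / (2 * sqrt (real (card U) - 1))"
proof -
  let ?C = "full_cycles U" and ?G = "{g. g permutes U}"
  define P where "P = map_pmf (\<lambda>(x, y). x \<circ> y) (pair_pmf (pmf_of_set ?C) (pmf_of_set K))"
  define N where "N = real (card U) - 1"
  define L where "L = real (max 1 l)"
  have N: "N > 0" "real (card U - 1) = N" using n by (auto simp: N_def)
  have finG: "finite ?G" using U by (simp add: finite_permutations)
  have Cp: "x permutes U" if "x \<in> ?C" for x using that by (simp add: full_cycles_def)
  have Kp: "x permutes U" if "x \<in> K" for x using that K by (simp add: conj_closed_def)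
  have finC: "finite ?C" and finK: "finite K"
    using finite_subset[OF _ finG, of ?C] finite_subset[OF _ finG, of K] Cp Kp by auto
  have cC: "real (card U) * real (card ?C) = fact (card U)"
    using card_full_cycles[OF U] n by (metis card.empty not_numeral_le_zero of_nat_fact of_nat_mult)
  then have C0: "?C \<noteq> {}" by auto
  have pos: "real (card ?C) > 0" "real (card K) > 0" "real (card U) > 0"
    using C0 K(2) finC finK U n by (auto simp: card_gt_0_iff)
  have P: "pmf P g = card {(x, y) \<in> ?C \<times> K. x \<circ> y = g} / (real (card ?C) * real (card K))" for g
    unfolding P_def using finC finK C0 K(2) by (rule pmf_product_of_sets)
  have sp: "set_pmf P \<subseteq> X" using prod finC finK C0 K(2) by (auto simp: P_def)
  let ?S = "\<Sum>x\<in>?C. \<Sum>y\<in>K. \<Sum>z\<in>K. if x \<circ> y \<circ> inv' z \<in> ?C then 1 else (0::real)"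
  have sq: "(\<Sum>g\<in>?G. (pmf P g)\<^sup>2) = ?S / (real (card ?C) * real (card K))\<^sup>2"
    using sum_card_factorizations_squared[OF U Cp Kp]
    by (simp add: P power_divide flip: sum_divide_distrib)
  have cX: "real (card X) = real (card U) * real (card ?C) / 2"
    using X(2) cC by (metis nonzero_mult_div_cancel_left of_nat_fact of_nat_mult of_nat_numeral zero_neq_numeral)
  have scale: "(a * b / 2) * (s / (b * c)\<^sup>2) = a * s / (2 * b * c\<^sup>2)" if "b > 0" for a b c s :: real
    using that by (simp add: field_simps power2_eq_square)
  have "card X * (\<Sum>g\<in>?G. (pmf P g)\<^sup>2)
      = (real (card U) * ?S) / (2 * real (card ?C) * (real (card K))\<^sup>2)"
    unfolding sq cX using pos(1) by (rule scale)
  also have "\<dots> \<le> (card ?C * (real (card K))\<^sup>2 * (2 + 2 * L\<^sup>2 / N)) / (2 * real (card ?C) * (real (card K))\<^sup>2)"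
    using card_triples_full_cycles_le[OF U n K(1) fixed] N(2)
    by (intro divide_right_mono) (auto simp: L_def)
  also have "\<dots> = 1 + L\<^sup>2 / N" using pos N by (simp add: field_simps)
  finally have "tv_dist ?G P (pmf_of_set X) \<le> sqrt (L\<^sup>2 / N) / 2"
    using X(1) finG sp set_pmf_not_empty[of P] by (intro tv_dist_uniform_le) auto
  also have "sqrt (L\<^sup>2 / N) / 2 = L / (2 * sqrt N)"
    by (simp add: real_sqrt_divide L_def)
  finally show ?thesis by (simp add: P_def L_def N_def)
qed

section \<open>Cycle types and conjugacy classes\<close>

lemma cycle_class_full:
  assumes n: "1 \<le> n"
  shows "cycle_class n {#n#} = full_cycles {1..n}"
proof (rule equalityI; rule subsetI)
  fix x assume "x \<in> cycle_class n {#n#}"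
  then have x: "x permutes {1..n}" and t: "cycle_type n x = {#n#}"
    by (auto simp: cycle_class_def sym_group_carrier)
  let ?O = "orbit x ` {1..n}"
  have "size (cycle_type n x) = card ?O" by (simp add: cycle_type_def)
  then have "card ?O = 1" using t by simp
  then obtain D where D: "?O = {D}" by (rule card_1_singletonE)
  then have cD: "card D = n" using t by (simp add: cycle_type_def)
  have "orbit x 1 = D" using D n by auto
  then have "D \<subseteq> {1..n}" "cyclic_on x D"
    using permutes_orbit_subset[OF x, of 1] cyclic_on_orbit[OF x, of 1] n by auto
  moreover from this have "D = {1..n}" using cD by (intro card_subset_eq) auto
  ultimately show "x \<in> full_cycles {1..n}" using x by (simp add: full_cycles_def)
next
  fix x assume "x \<in> full_cycles {1..n}"
  then have x: "x permutes {1..n}" and c: "cyclic_on x {1..n}" by (auto simp: full_cycles_def)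
  have "orbit x ` {1..n} = {{1..n}}"
    using orbit_cyclic_eq3[OF c] n by (auto simp: image_iff)
  then show "x \<in> cycle_class n {#n#}"
    using x by (simp add: cycle_class_def sym_group_carrier cycle_type_def)
qed

text \<open>\<open>h\<close> maps the orbits of \<open>x\<close> onto those of the conjugate; being
  injective, it identifies no two orbits and preserves their sizes.\<close>

lemma cycle_type_conj:
  assumes x: "x permutes {1..n}" and h: "h permutes {1..n}"
  shows "cycle_type n (h \<circ> x \<circ> inv' h) = cycle_type n x"
proof -
  have perm: "permutation x" using x by (auto simp: permutation_permutes)
  have orb: "orbit (h \<circ> x \<circ> inv' h) (h y) = h ` orbit x y" for y
    using permutation_self_in_orbit[OF perm, of y] permutes_inverses(2)[OF h]
    by (intro orbit_inverse[symmetric]) auto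
  have "orbit (h \<circ> x \<circ> inv' h) ` {1..n} = orbit (h \<circ> x \<circ> inv' h) ` h ` {1..n}"
    using permutes_image[OF h] by simp
  also have "\<dots> = image h ` orbit x ` {1..n}" by (simp add: image_image orb)
  finally have O: "orbit (h \<circ> x \<circ> inv' h) ` {1..n} = image h ` orbit x ` {1..n}" .
  have inj: "inj_on (image h) A" for A
    using permutes_inj[OF h] by (auto simp: inj_on_def inj_image_eq_iff)
  have "cycle_type n (h \<circ> x \<circ> inv' h) = image_mset (\<lambda>A. card (h ` A)) (mset_set (orbit x ` {1..n}))"
    unfolding cycle_type_def O image_mset_mset_set[OF inj, symmetric]
    by (simp add: multiset.map_comp o_def)
  also have "\<dots> = cycle_type n x"
    using card_image[OF inj_on_subset[OF permutes_inj[OF h] subset_UNIV]] by (simp add: cycle_type_def)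
  finally show ?thesis .
qed

lemma conj_closed_cycle_class: "conj_closed {1..n} (cycle_class n \<alpha>)"
  unfolding conj_closed_def cycle_class_def
  by (auto simp: sym_group_carrier cycle_type_conj intro!: permutes_compose permutes_inv)

text \<open>Parts of size 1 are the singleton orbits, which correspond to the fixed points.\<close>

lemma card_fixed_points_cycle_class:
  assumes "x \<in> cycle_class n \<alpha>"
  shows "card {y \<in> {1..n}. x y = y} = count \<alpha> 1"
proof -
  have x: "x permutes {1..n}" and t: "cycle_type n x = \<alpha>"
    using assms by (auto simp: cycle_class_def sym_group_carrier)
  have perm: "permutation x" using x by (auto simp: permutation_permutes)
  let ?O = "orbit x ` {1..n}"
  have "{D \<in> ?O. card D = 1} = (\<lambda>y. {y}) ` {y \<in> {1..n}. x y = y}"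
  proof (rule equalityI; rule subsetI)
    fix D assume D: "D \<in> {D \<in> ?O. card D = 1}"
    then obtain y where y: "y \<in> {1..n}" "D = orbit x y" by blast
    obtain z where "D = {z}" using D by (auto simp: card_1_singleton_iff)
    then have "D = {y}" using y(2) permutation_self_in_orbit[OF perm, of y] by simp
    then show "D \<in> (\<lambda>y. {y}) ` {y \<in> {1..n}. x y = y}"
      using y orbit_eq_singleton_iff[of x y] by simp
  next
    fix D assume "D \<in> (\<lambda>y. {y}) ` {y \<in> {1..n}. x y = y}"
    then obtain y where "y \<in> {1..n}" "x y = y" "D = {y}" by auto
    then show "D \<in> {D \<in> ?O. card D = 1}" using orbit_eq_singleton_iff[of x y] by force
  qed
  then have "card {D \<in> ?O. card D = 1} = card {y \<in> {1..n}. x y = y}"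
    by (simp add: card_image)
  moreover have "count (cycle_type n x) 1 = card {D \<in> ?O. card D = 1}"
    unfolding cycle_type_def by (subst count_image_mset_eq_card_vimage) auto
  ultimately show ?thesis using t by simp
qed

text \<open>Induction on the parts: a permutation for the remaining parts is extended by a cycle on
  \<open>r\<close> new points at the end of the interval. Nonemptiness is what gives
  \<open>pmf_of_set\<close> its meaning on the class.\<close>

lemma cycle_class_nonempty:
  assumes "is_partition \<alpha> n"
  shows "cycle_class n \<alpha> \<noteq> {}"
  using assms
proof (induction \<alpha> arbitrary: n)
  case empty
  then have "id \<in> cycle_class n {#}"
    by (simp add: is_partition_def cycle_class_def cycle_type_def sym_group_carrier)
  then show ?case by blast
next
  case (add r \<alpha>)
  define n' where "n' = sum_mset \<alpha>"
  have r: "1 \<le> r" and n: "n = n' + r" using add.prems by (auto simp: is_partition_def n'_def)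
  have "is_partition \<alpha> n'" using add.prems by (auto simp: is_partition_def n'_def)
  then obtain x where x: "x permutes {1..n'}" "cycle_type n' x = \<alpha>"
    using add.IH by (fastforce simp: cycle_class_def sym_group_carrier)
  let ?D = "{n' + 1..n}"
  \<comment> \<open>The existence of a cycle on the new points comes from the count of full
    cycles.\<close>
  have "card (full_cycles ?D) \<noteq> 0"
    using card_full_cycles[of ?D] r n by (metis atLeastatMost_empty_iff2 add_le_cancel_left fact_nonzero finite_atLeastAtMost mult_0_right)
  then obtain c where c: "c permutes ?D" "cyclic_on c ?D"
    by (metis (mono_tags, lifting) card.empty equals0I full_cycles_def mem_Collect_eq)
  define g where "g = x \<circ> c"
  have "x permutes {1..n}" using x(1) by (rule permutes_subset) (use n in auto)
  moreover have "c permutes {1..n}" using c(1) by (rule permutes_subset) auto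
  ultimately have g: "g permutes {1..n}" unfolding g_def by (simp add: permutes_compose)
  have perm: "permutation x" using x(1) by (auto simp: permutation_permutes)
  have orb1: "orbit g y = orbit x y" if y: "y \<in> {1..n'}" for y
  proof (rule orbit_cong)
    show "y \<in> orbit x y" using perm by (rule permutation_self_in_orbit)
    fix s assume "s \<in> orbit x y"
    then have "s \<in> {1..n'}" using permutes_orbit_subset[OF x(1) y] by blast
    then show "g s = x s" using permutes_not_in[OF c(1), of s] by (simp add: g_def)
  qed
  have "g s = c s" if "s \<in> ?D" for s
  proof -
    have "c s \<in> ?D" using that permutes_in_image[OF c(1)] by blast
    then show ?thesis using permutes_not_in[OF x(1), of "c s"] by (simp add: g_def)
  qed
  then have "cyclic_on g ?D" using c(2) cyclic_cong[of ?D g c] by blast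
  then have orb2: "orbit g y = ?D" if "y \<in> ?D" for y using that by (rule orbit_cyclic_eq3)
  have "{1..n} = {1..n'} \<union> ?D" using n by auto
  then have "orbit g ` {1..n} = orbit g ` {1..n'} \<union> orbit g ` ?D" by (metis image_Un)
  also have "orbit g ` {1..n'} = orbit x ` {1..n'}" using orb1 by (intro image_cong refl)
  also have "orbit g ` ?D = (\<lambda>_. ?D) ` ?D" using orb2 by (intro image_cong refl)
  also have "\<dots> = {?D}" using r n by (intro image_constant) auto
  finally have O: "orbit g ` {1..n} = insert ?D (orbit x ` {1..n'})" by simp
  have "?D \<notin> orbit x ` {1..n'}"
  proof
    assume "?D \<in> orbit x ` {1..n'}"
    then obtain y where y: "y \<in> {1..n'}" "?D = orbit x y" by blast
    then have "?D \<subseteq> {1..n'}" using permutes_orbit_subset[OF x(1) y(1)] by metis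
    then show False using r n by auto
  qed
  then have "cycle_type n g = add_mset r \<alpha>"
    using x(2) n unfolding cycle_type_def O by simp
  then show ?case using g by (auto simp: cycle_class_def sym_group_carrier)
qed

theorem theorem1:
  fixes n :: nat and lam :: "nat multiset"
  assumes "n \<ge> 2" and "is_partition lam n"
  shows "(same_parity n {#n#} lam \<longrightarrow>
            tv_dist (carrier (sym_group n)) (class_product_pmf n {#n#} lam)
              (pmf_of_set (carrier (alt_group n)))
            \<le> real (max 1 (count lam 1)) / (2 * sqrt (real n - 1)))
       \<and> (opposite_parity n {#n#} lam \<longrightarrow>
            tv_dist (carrier (sym_group n)) (class_product_pmf n {#n#} lam)
              (pmf_of_set (carrier (sym_group n) - carrier (alt_group n)))
            \<le> real (max 1 (count lam 1)) / (2 * sqrt (real n - 1)))"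
proof -
  let ?S = "carrier (sym_group n)" and ?A = "carrier (alt_group n)"
  let ?C = "full_cycles {1..n}" and ?K = "cycle_class n lam"
  have S: "?S = {g. g permutes {1..n}}" by (auto simp: sym_group_carrier)
  have AS: "?A \<subseteq> ?S" by (auto simp: sym_group_carrier alt_group_carrier)
  have cA: "2 * card ?A = fact n" using assms(1) by (rule alt_group_card_carrier)
  have "card (?S - ?A) = fact n - card ?A"
    using AS sym_group_card_carrier[of n] finite_permutations[of "{1..n}"] finite_subset[OF AS]
    by (subst card_Diff_subset) (auto simp: S)
  then have cSA: "2 * card (?S - ?A) = fact n" using cA by simp
  have C: "cycle_class n {#n#} = ?C" using assms(1) by (intro cycle_class_full) simp
  \<comment> \<open>\<open>X\<close> will be the alternating group or its complement; what is left
    to the two cases is to see in which of them the products lie.\<close>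
  have bound: "tv_dist ?S (class_product_pmf n {#n#} lam) (pmf_of_set X)
      \<le> real (max 1 (count lam 1)) / (2 * sqrt (real n - 1))"
    if "X \<subseteq> ?S" "2 * card X = fact n" "\<And>x y. x \<in> ?C \<Longrightarrow> y \<in> ?K \<Longrightarrow> x \<circ> y \<in> X" for X
    using tv_dist_full_cycles_product_le[of "{1..n}" ?K "count lam 1" X]
      conj_closed_cycle_class[of n lam] cycle_class_nonempty[OF assms(2)]
      card_fixed_points_cycle_class[of _ n lam] that assms(1)
    by (simp add: class_product_pmf_def C S)
  have prod: "x \<circ> y \<in> ?S" "evenperm (x \<circ> y) \<longleftrightarrow> evenperm x = evenperm y"
    if "x \<in> ?C" "y \<in> ?K" for x y
  proof -
    have "x permutes {1..n}" "y permutes {1..n}"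
      using that by (auto simp: full_cycles_def cycle_class_def sym_group_carrier)
    then show "x \<circ> y \<in> ?S" "evenperm (x \<circ> y) \<longleftrightarrow> evenperm x = evenperm y"
      by (auto simp: sym_group_carrier permutes_compose permutation_permutes intro!: evenperm_comp)
  qed
  show ?thesis
  proof (intro conjI impI)
    assume "same_parity n {#n#} lam"
    then have "evenperm x = evenperm y" if "x \<in> ?C" "y \<in> ?K" for x y
      using that by (auto simp: same_parity_def even_partition_def odd_partition_def C)
    then show "tv_dist ?S (class_product_pmf n {#n#} lam) (pmf_of_set ?A)
        \<le> real (max 1 (count lam 1)) / (2 * sqrt (real n - 1))"
      using prod AS cA by (intro bound) (auto simp: alt_group_carrier sym_group_carrier)
  next
    assume "opposite_parity n {#n#} lam"
    then have "evenperm x \<noteq> evenperm y" if "x \<in> ?C" "y \<in> ?K" for x y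
      using that by (auto simp: opposite_parity_def even_partition_def odd_partition_def C)
    then show "tv_dist ?S (class_product_pmf n {#n#} lam) (pmf_of_set (?S - ?A))
        \<le> real (max 1 (count lam 1)) / (2 * sqrt (real n - 1))"
      using prod cSA by (intro bound) (auto simp: alt_group_carrier sym_group_carrier)
  qed
qed

end
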